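(* Let $h,\nu\in\mathbb{R}_{>0}$, let $r\in\mathbb{Z}_{\ge 0}$, let $\mu,\delta,\lambda,a,b,f_1,\dots,f_r\in\mathbb{C}$ with $\Re(\mu)>0$ and no $f_j$ or $\mu$ a non-positive integer, and let $m_1,\dots,m_r\in\mathbb{Z}_{\geq 0}$, $m:=m_1+\cdots+m_r$. Let $\mathcal{I}$ and $\mathcal{J}$ be the fractional integral operators of the first and second kind with these parameters, and let $\mathfrak{c}_1(\lambda)$, $\mathfrak{p}_k$, $A_k$ $(0\le k\le m)$ be the associated quantities (all defined in the context). Assume $$\Re(\mathfrak{c}_1(\lambda))>-\min[0,\Re(\mathfrak{p}_m)].$$ Let $\varphi:\mathbb{R}_{>0}\to\mathbb{C}$ be such that $x^{\lambda-\delta}\varphi(x)\in L^1(\mathbb{R}_{>0})$. Then, for every $s\in\mathbb{C}$ with $\Re(s)>0$, $$\mathcal{L}[x^\lambda\,\mathcal{J}\varphi](s)=\int_{0}^{\infty}K_{\mathcal{J}}(s,x)\,\varphi(x)\,\mathrm{d}x,$$ where, for $x>0$, $K_{\mathcal{J}}(s,x)$ is the value at the point $x$ of the operator $\mathcal{I}$ applied to the function $t\mapsto t^\lambda \mathrm{e}^{-st}$, and $$K_{\mathcal{J}}(s,x)=x^{\lambda-\delta}\sum_{k=0}^{m}\frac{A_k}{A_0}(a)_k(b)_k\; {}_{2}\Psi_{2}\left[\left.\begin{matrix}(\mathfrak{c}_1(\lambda),1/\nu),\ (\mathfrak{c}_1(\lambda)+\mathfrak{p}_k,1/\nu)\\(\mathfrak{c}_1(\lambda)+\mu-a,1/\nu),\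 (\mathfrak{c}_1(\lambda)+\mu-b,1/\nu)\end{matrix}\right|-sx\right].$$
   Context: Notation. $\mathbb{R}_{>0}=(0,\infty)$; $\mathbb{Z}_{\ge 0}$ is the set of non-negative integers. The Pochhammer symbol is $(a)_0=1$, $(a)_k=a(a+1)\cdots(a+k-1)$ for $k\geq 1$. Empty products equal $1$. $L^1(\mathbb{R}_{>0})$ is the space of Lebesgue measurable functions $g:\mathbb{R}_{>0}\to\mathbb{C}$ with $\int_0^\infty|g(t)|\,\mathrm{d}t<\infty$. The Laplace transform is $\mathcal{L}[g](s)=\int_0^\infty \mathrm{e}^{-st}g(t)\,\mathrm{d}t$; $\mathcal{L}[x^\lambda\mathcal{J}\varphi](s)$ means the Laplace transform of the function $x\mapsto x^\lambda(\mathcal{J}\varphi)(x)$. Hypergeometric function. For $|z|<1$, $${}_{r+2}F_{r+1}\left[\begin{matrix}a,b,(f_r+m_r)\\ \mu,(f_r)\end{matrix};z\right]=\sum_{k=0}^\infty\frac{(a)_k(b)_k\prod_{j=1}^r(f_j+m_j)_k}{(\mu)_k\prod_{j=1}^r(f_j)_k}\frac{z^k}{k!},$$ where $(f_r+m_r)$ abbreviates the list $f_1+m_1,\dots,f_r+m_r$ and $(f_r)$ the list $f_1,\dots,f_r$. Operators. For $x>0$ and a complex-valued function $\varphi$ on $\mathbb{R}_{>0}$ for which the integrals exist, $$(\mathcal{I}\varphi)(x)=\frac{\nu x^{-\delta-\nu(\mu+h)}}{\Gamma(\mu)}\int_0^x(x^\nu-t^\nu)^{\mu-1}\,{}_{r+2}F_{r+1}\left[\begin{matrix}a,b,(f_r+m_r)\\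 \mu,(f_r)\end{matrix};1-\frac{t^\nu}{x^\nu}\right]\varphi(t)\,t^{\nu h+\nu-1}\,\mathrm{d}t,$$ $$(\mathcal{J}\varphi)(x)=\frac{\nu x^{\nu h+\nu-1}}{\Gamma(\mu)}\int_x^\infty(t^\nu-x^\nu)^{\mu-1}\,{}_{r+2}F_{r+1}\left[\begin{matrix}a,b,(f_r+m_r)\\ \mu,(f_r)\end{matrix};1-\frac{x^\nu}{t^\nu}\right]\varphi(t)\,t^{-\delta-\nu(\mu+h)}\,\mathrm{d}t.$$ Auxiliary quantities. $\mathfrak{c}_1(t):=1+h+\frac{t}{\nu}$ and $\mathfrak{p}_k:=\mu-a-b-k$ for $k\in\mathbb{Z}_{\ge0}$. The numbers $\sigma_0,\dots,\sigma_m$ are defined by the polynomial identity $(f_1+x)_{m_1}\cdots(f_r+x)_{m_r}=\sum_{j=0}^m\sigma_{m-j}x^j$, and $$A_k=\sum_{j=k}^m{j\brace k}\sigma_{m-j}\quad(0\le k\le m),$$ where ${j\brace k}$ are the Stirling numbers of the second kind; in particular $A_0=(f_1)_{m_1}\cdots(f_r)_{m_r}$ and $A_m=1$. Fox-Wright function. $${}_{p}\Psi_{q}\left[\left.\begin{matrix}(a_1,\alpha_1),\dots,(a_p,\alpha_p)\\(b_1,\beta_1),\dots,(b_q,\beta_q)\end{matrix}\right|z\right]=\sum_{k=0}^\infty\frac{\prod_{j=1}^p\Gamma(a_j+\alpha_jk)}{\prod_{j=1}^q\Gamma(b_j+\beta_jk)}\frac{z^k}{k!},$$ with $1/\Gamma$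 equal to $0$ at the poles of $\Gamma$; the series converges absolutely for all $z\in\mathbb{C}$ when $\sum_j\beta_j-\sum_j\alpha_j>-1$. *)

theory Defs
  imports
    "HOL-Analysis.Analysis"
    "HOL-Computational_Algebra.Formal_Power_Series"
    "HOL-Computational_Algebra.Polynomial"
    "HOL-Combinatorics.Stirling"
begin

text \<open>
  Throughout, the families $f_1,\dots,f_r$ and $m_1,\dots,m_r$ are the values of functions on the
  index set \<open>{1..r}\<close>; other values are irrelevant. Functions on $(0,\infty)$ are represented by
  functions on \<open>real\<close> whose values outside $(0,\infty)$ are irrelevant. All integrals are Lebesgue
  integrals, and complex powers are only used with positive real base.
\<close>

definition hyp_F ::
    "complex \<Rightarrow> complex \<Rightarrow> complex \<Rightarrow> nat \<Rightarrow> (nat \<Rightarrow> complex) \<Rightarrow> (nat \<Rightarrow> nat) \<Rightarrow> complex \<Rightarrow> complex" where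
  "hyp_F a b \<mu> r f ms z =
     eval_fps (fps_hypergeo (a # b # map (\<lambda>j. f j + of_nat (ms j)) [1..<Suc r])
                            (\<mu> # map f [1..<Suc r]) 1) z"

definition I_integrand ::
    "real \<Rightarrow> real \<Rightarrow> complex \<Rightarrow> complex \<Rightarrow> complex \<Rightarrow> nat \<Rightarrow> (nat \<Rightarrow> complex) \<Rightarrow> (nat \<Rightarrow> nat) \<Rightarrow>
     (real \<Rightarrow> complex) \<Rightarrow> real \<Rightarrow> real \<Rightarrow> complex" where
  "I_integrand h \<nu> \<mu> a b r f ms \<phi> x t =
     of_real (x powr \<nu> - t powr \<nu>) powr (\<mu> - 1)
       * hyp_F a b \<mu> r f ms (of_real (1 - t powr \<nu> / x powr \<nu>))
       * \<phi> t * of_real (t powr (\<nu> * h + \<nu> - 1))"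

definition frac_I ::
    "real \<Rightarrow> real \<Rightarrow> complex \<Rightarrow> complex \<Rightarrow> complex \<Rightarrow> complex \<Rightarrow> nat \<Rightarrow> (nat \<Rightarrow> complex) \<Rightarrow> (nat \<Rightarrow> nat) \<Rightarrow>
     (real \<Rightarrow> complex) \<Rightarrow> real \<Rightarrow> complex" where
  "frac_I h \<nu> \<mu> \<delta> a b r f ms \<phi> x =
     of_real \<nu> * of_real x powr (- \<delta> - of_real \<nu> * (\<mu> + of_real h)) / Gamma \<mu>
       * (LINT t:{0<..<x}|lebesgue. I_integrand h \<nu> \<mu> a b r f ms \<phi> x t)"

definition J_integrand ::
    "real \<Rightarrow> real \<Rightarrow> complex \<Rightarrow> complex \<Rightarrow> complex \<Rightarrow> complex \<Rightarrow> nat \<Rightarrow> (nat \<Rightarrow> complex) \<Rightarrow> (nat \<Rightarrow> nat) \<Rightarrow>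
     (real \<Rightarrow> complex) \<Rightarrow> real \<Rightarrow> real \<Rightarrow> complex" where
  "J_integrand h \<nu> \<mu> \<delta> a b r f ms \<phi> x t =
     of_real (t powr \<nu> - x powr \<nu>) powr (\<mu> - 1)
       * hyp_F a b \<mu> r f ms (of_real (1 - x powr \<nu> / t powr \<nu>))
       * \<phi> t * of_real t powr (- \<delta> - of_real \<nu> * (\<mu> + of_real h))"

definition frac_J ::
    "real \<Rightarrow> real \<Rightarrow> complex \<Rightarrow> complex \<Rightarrow> complex \<Rightarrow> complex \<Rightarrow> nat \<Rightarrow> (nat \<Rightarrow> complex) \<Rightarrow> (nat \<Rightarrow> nat) \<Rightarrow>
     (real \<Rightarrow> complex) \<Rightarrow> real \<Rightarrow> complex" where
  "frac_J h \<nu> \<mu> \<delta> a b r f ms \<phi> x =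
     of_real \<nu> * of_real (x powr (\<nu> * h + \<nu> - 1)) / Gamma \<mu>
       * (LINT t:{x<..}|lebesgue. J_integrand h \<nu> \<mu> \<delta> a b r f ms \<phi> x t)"

definition laplace :: "(real \<Rightarrow> complex) \<Rightarrow> complex \<Rightarrow> complex" where
  "laplace g s = (LINT t:{0<..}|lebesgue. exp (- s * of_real t) * g t)"

definition power_exp :: "complex \<Rightarrow> complex \<Rightarrow> real \<Rightarrow> complex" where
  "power_exp lam s t = of_real t powr lam * exp (- s * of_real t)"

definition kernel_J ::
    "real \<Rightarrow> real \<Rightarrow> complex \<Rightarrow> complex \<Rightarrow> complex \<Rightarrow> complex \<Rightarrow> complex \<Rightarrow> nat \<Rightarrow> (nat \<Rightarrow> complex) \<Rightarrow>
     (nat \<Rightarrow> nat) \<Rightarrow> complex \<Rightarrow> real \<Rightarrow> complex" where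
  "kernel_J h \<nu> \<mu> \<delta> lam a b r f ms s x = frac_I h \<nu> \<mu> \<delta> a b r f ms (power_exp lam s) x"

definition c1 :: "real \<Rightarrow> real \<Rightarrow> complex \<Rightarrow> complex" where
  "c1 h \<nu> t = 1 + of_real h + t / of_real \<nu>"

definition pk :: "complex \<Rightarrow> complex \<Rightarrow> complex \<Rightarrow> nat \<Rightarrow> complex" where
  "pk \<mu> a b k = \<mu> - a - b - of_nat k"

definition shift_poly :: "nat \<Rightarrow> (nat \<Rightarrow> complex) \<Rightarrow> (nat \<Rightarrow> nat) \<Rightarrow> complex poly" where
  "shift_poly r f ms = (\<Prod>j=1..r. pochhammer [:f j, 1:] (ms j))"

text \<open>Only the values \<open>sigma r f ms i\<close> with $i \le m_1+\dots+m_r$ are meaningful.\<close>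

definition sigma :: "nat \<Rightarrow> (nat \<Rightarrow> complex) \<Rightarrow> (nat \<Rightarrow> nat) \<Rightarrow> nat \<Rightarrow> complex" where
  "sigma r f ms i = coeff (shift_poly r f ms) ((\<Sum>j=1..r. ms j) - i)"

lemma sigma_identity:
  "(\<Prod>j=1..r. pochhammer (f j + x) (ms j)) =
     (\<Sum>j=0..(\<Sum>i=1..r. ms i). sigma r f ms ((\<Sum>i=1..r. ms i) - j) * x ^ j)"
proof -
  let ?M = "\<Sum>i=1..r. ms i"
  have ev: "poly (shift_poly r f ms) x = (\<Prod>j=1..r. pochhammer (f j + x) (ms j))"
    by (simp add: shift_poly_def poly_prod pochhammer_prod algebra_simps)
  have "degree (pochhammer [:f j, 1:] n) \<le> n" for j n
  proof (induction n)
    case (Suc n)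
    have "degree ([:f j, 1:] + of_nat n) \<le> 1"
      by (rule order.trans[OF degree_add_le_max]) auto
    then show ?case
      using degree_mult_le[of "pochhammer [:f j, 1:] n" "[:f j, 1:] + of_nat n"] Suc
      by (simp add: pochhammer_Suc)
  qed auto
  then have "degree (shift_poly r f ms) \<le> ?M"
    unfolding shift_poly_def
    by (intro order.trans[OF degree_prod_sum_le] sum_mono) auto
  then have "shift_poly r f ms = (\<Sum>j\<le>?M. monom (coeff (shift_poly r f ms) j) j)"
    by (simp add: poly_as_sum_of_monoms')
  then have "poly (shift_poly r f ms) x = poly (\<Sum>j\<le>?M. monom (coeff (shift_poly r f ms) j) j) x"
    by (rule arg_cong)
  then have "poly (shift_poly r f ms) x = (\<Sum>j\<le>?M. coeff (shift_poly r f ms) j * x ^ j)"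
    by (simp add: poly_sum poly_monom)
  then show ?thesis
    unfolding ev by (simp add: sigma_def atLeast0AtMost)
qed

definition coeff_A :: "nat \<Rightarrow> (nat \<Rightarrow> complex) \<Rightarrow> (nat \<Rightarrow> nat) \<Rightarrow> nat \<Rightarrow> complex" where
  "coeff_A r f ms k =
     (\<Sum>j=k..(\<Sum>i=1..r. ms i). of_nat (Stirling j k) * sigma r f ms ((\<Sum>i=1..r. ms i) - j))"

text \<open>The function \<open>rGamma\<close> is $1/\Gamma$, extended by $0$ at the poles of $\Gamma$.\<close>

definition fox_wright ::
    "(complex \<times> real) list \<Rightarrow> (complex \<times> real) list \<Rightarrow> complex \<Rightarrow> complex" where
  "fox_wright as bs z =
     (\<Sum>k. (\<Prod>(a, \<alpha>)\<leftarrow>as. Gamma (a + of_real \<alpha> * of_nat k))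
           * (\<Prod>(b, \<beta>)\<leftarrow>bs. rGamma (b + of_real \<beta> * of_nat k)) * z ^ k / fact k)"

end

theory Submission
  imports Defs
begin

text \<open>
  The transform of \<open>x powr lam * frac_J \<phi> x\<close> is an iterated integral over the wedge \<open>0 < x < t\<close>. The kernels of
  the two operators agree up to powers of their arguments, so that exchanging the order of integration
  produces the operator of the first kind applied to \<open>power_exp lam s\<close>, integrated against \<open>\<phi>\<close>. Two things
  have to be shown: that the exchange is legitimate, and that the inner integral is a sum of Fox-Wright
  functions.

  Both come from a substitution. The operator of the first kind at \<open>x\<close> is an integral over \<open>0 < t < x\<close>; with
  \<open>u = (t / x) powr \<nu>\<close> it becomes \<open>x powr (lam - \<delta>)\<close> times an integral over the unit interval of
  \<open>u powr (C - 1) * (1 - u) powr (\<mu> - 1) * hyp_F (1 - u) * exp (- s * x * u powr (1 / \<nu>))\<close>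
  (\<open>I_integrand_rescale\<close>).
  For \<open>Re s > 0\<close> the exponential has norm at most \<open>1\<close>. Hence absolute integrability without the exponential
  bounds the integral of the norms by a constant multiple of \<open>norm (x powr (lam - \<delta>))\<close>, and Fubini's
  theorem applies because \<open>x powr (lam - \<delta>) * \<phi> x\<close> is integrable (\<open>joint_integrable\<close>).

  The integral over the unit interval is computed in three steps. The parameters \<open>f j + ms j\<close> and \<open>f j\<close> differ by
  natural numbers, so they contribute a polynomial in the summation index; expanded in falling
  factorials, with coefficients \<open>coeff_A\<close>, it splits the hypergeometric function into finitely many functions
  \<open>\<^sub>2F\<^sub>1\<close> with parameters raised by \<open>k\<close> (\<open>hyp_F_decomposition\<close>). For each of these, integration term by term
  against \<open>u powr (c - 1)\<close> gives Beta integrals that add up to a \<open>\<^sub>2F\<^sub>1\<close> at \<open>1\<close>, evaluated by Gauss's theorem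
  (\<open>gauss_sum\<close>, \<open>euler_kernel_integral\<close>); this is where \<open>Re (C + pk \<mu> a b k) > 0\<close> enters, and the same
  estimate proves absolute integrability. Finally the exponential is expanded: its \<open>n\<close>-th term shifts \<open>c\<close> by
  \<open>n / \<nu>\<close>, and the resulting series is the Fox-Wright function (\<open>euler_kernel_exp_integral\<close>).
\<close>

section \<open>Growth of Pochhammer symbols\<close>

lemma Re_pos_not_nonpos_Int: "Re z > 0 \<Longrightarrow> z \<notin> \<int>\<^sub>\<le>\<^sub>0"
  by (auto simp: complex_eq_iff elim!: nonpos_Ints_cases)

lemma not_nonpos_Int_add_nat:
  fixes D :: complex
  assumes "D \<notin> \<int>\<^sub>\<le>\<^sub>0"
  shows "D + of_nat n \<notin> \<int>\<^sub>\<le>\<^sub>0"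
  using assms nonpos_Ints_diff_Nats[of "D + of_nat n" "of_nat n"] by auto

lemma pochhammer_real_nonneg: "x \<ge> 0 \<Longrightarrow> pochhammer (x::real) n \<ge> 0"
  by (induction n) (auto simp: pochhammer_Suc)

text \<open>
  Euler's limit \<open>rGamma_series z \<longlonglongrightarrow> rGamma z\<close> says that \<open>pochhammer z (Suc n)\<close> is comparable to
  \<open>fact n * n powr z\<close>. A convergent sequence is bounded, which gives the upper estimate; the reciprocal
  sequence converges only away from the poles of \<open>Gamma\<close>, which is where the lower estimate holds.
\<close>
lemma norm_pochhammer_upper:
  fixes z :: complex
  shows "\<exists>C>0. \<forall>n\<ge>1. norm (pochhammer z (Suc n)) \<le> C * fact n * real n powr Re z"
proof -
  have "Bseq (rGamma_series z)"
    using rGamma_series_LIMSEQ convergentI Bseq_eq_bounded convergent_imp_Bseq by blast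
  then obtain C where C: "C > 0" "\<And>n. norm (rGamma_series z n) \<le> C"
    unfolding Bseq_def by blast
  have "norm (pochhammer z (Suc n)) \<le> C * fact n * real n powr Re z" if "n \<ge> 1" for n
    using C(2)[of n] that
    by (simp add: rGamma_series_def norm_divide norm_mult powr_def field_simps)
  with C(1) show ?thesis by blast
qed

lemma norm_pochhammer_lower:
  fixes z :: complex
  assumes "z \<notin> \<int>\<^sub>\<le>\<^sub>0"
  shows "\<exists>C>0. \<forall>n\<ge>1. fact n * real n powr Re z \<le> C * norm (pochhammer z (Suc n))"
proof -
  have "Bseq (Gamma_series z)"
    using Gamma_series_LIMSEQ convergentI Bseq_eq_bounded convergent_imp_Bseq by blast
  then obtain C where C: "C > 0" "\<And>n. norm (Gamma_series z n) \<le> C"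
    unfolding Bseq_def by blast
  have "fact n * real n powr Re z \<le> C * norm (pochhammer z (Suc n))" if "n \<ge> 1" for n
  proof -
    have "pochhammer z (Suc n) \<noteq> 0"
      using assms pochhammer_eq_0_imp_nonpos_Int by blast
    then show ?thesis
      using C(2)[of n] that
      by (simp add: Gamma_series_def norm_divide norm_mult powr_def field_simps)
  qed
  with C(1) show ?thesis by blast
qed

text \<open>
  The factor \<open>Suc n\<close> is kept on the left because both uses need it: divided out, it leaves a series
  dominated by \<open>n powr (- 1 - \<sigma>)\<close> with \<open>\<sigma> = Re (D - A - B)\<close>; left in place, it shows that \<open>n\<close> times the
  \<open>n\<close>-th term tends to \<open>0\<close>, which kills the boundary term of a telescoping sum.
\<close>
lemma hypergeo_term_bound:
  fixes A B D :: complex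
  assumes "D \<notin> \<int>\<^sub>\<le>\<^sub>0"
  shows "\<exists>C. \<forall>n\<ge>1. real (Suc n) * norm (pochhammer A (Suc n) * pochhammer B (Suc n)
            / (pochhammer D (Suc n) * fact (Suc n))) \<le> C * real n powr (- Re (D - A - B))"
proof -
  obtain C1 where C1: "C1 > 0"
      "\<And>n. n \<ge> 1 \<Longrightarrow> norm (pochhammer A (Suc n)) \<le> C1 * fact n * real n powr Re A"
    using norm_pochhammer_upper[of A] by auto
  obtain C2 where C2: "C2 > 0"
      "\<And>n. n \<ge> 1 \<Longrightarrow> norm (pochhammer B (Suc n)) \<le> C2 * fact n * real n powr Re B"
    using norm_pochhammer_upper[of B] by auto
  obtain C3 where C3: "C3 > 0"
      "\<And>n. n \<ge> 1 \<Longrightarrow> fact n * real n powr Re D \<le> C3 * norm (pochhammer D (Suc n))"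
    using norm_pochhammer_lower[OF assms] by auto
  have "real (Suc n) * norm (pochhammer A (Suc n) * pochhammer B (Suc n)
            / (pochhammer D (Suc n) * fact (Suc n)))
        \<le> (C1 * C2 * C3) * real n powr (- Re (D - A - B))" if n: "n \<ge> 1" for n
  proof -
    let ?a = "norm (pochhammer A (Suc n))" and ?b = "norm (pochhammer B (Suc n))"
      and ?d = "norm (pochhammer D (Suc n))" and ?F = "fact n :: real"
    have d: "?d > 0"
      using assms pochhammer_eq_0_imp_nonpos_Int by auto
    have F: "?F > 0" and P: "real n powr Re D > 0" using n by auto
    have "?a * ?b \<le> (C1 * ?F * real n powr Re A) * (C2 * ?F * real n powr Re B)"
      using C1 C2 n by (intro mult_mono) auto
    then have "?a * ?b * (?F * real n powr Re D)
        \<le> (C1 * ?F * real n powr Re A) * (C2 * ?F * real n powr Re B) * (C3 * ?d)"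
      using C1(1) C2(1) C3(1) C3(2)[OF n] by (intro mult_mono[OF _ C3(2)[OF n]]) auto
    also have "\<dots> = (C1 * C2 * C3) * ?F * ?F * ?d * (real n powr Re A * real n powr Re B)"
      by (simp add: mult_ac)
    also have "real n powr Re A * real n powr Re B
        = real n powr (- Re (D - A - B)) * real n powr Re D"
      by (simp add: add.commute flip: powr_add)
    finally have "(?a * ?b) * (?F * real n powr Re D)
        \<le> ((C1 * C2 * C3) * real n powr (- Re (D - A - B)) * ?F * ?d) * (?F * real n powr Re D)"
      by (simp add: mult_ac)
    then have "?a * ?b \<le> (C1 * C2 * C3) * real n powr (- Re (D - A - B)) * ?F * ?d"
      using mult_right_le_imp_le F P mult_pos_pos by blast
    moreover have "real (Suc n) * norm (pochhammer A (Suc n) * pochhammer B (Suc n)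
            / (pochhammer D (Suc n) * fact (Suc n))) = ?a * ?b / (?d * ?F)"
      unfolding norm_mult norm_divide fact_Suc norm_of_nat norm_fact by simp
    ultimately show ?thesis
      using d F by (simp add: pos_divide_le_eq mult_ac)
  qed
  then show ?thesis by blast
qed

section \<open>Gauss's summation theorem\<close>

text \<open>
  The terms of the series for \<open>\<^sub>2F\<^sub>1(A, B; D; 1) / Gamma D\<close>. Writing \<open>rGamma (D + n)\<close> for the quotient of
  \<open>rGamma D\<close> and \<open>pochhammer D n\<close> avoids a denominator, and in this form the contiguous relation below
  has polynomial coefficients.
\<close>
definition gauss_term :: "complex \<Rightarrow> complex \<Rightarrow> complex \<Rightarrow> nat \<Rightarrow> complex" where
  "gauss_term A B D n = pochhammer A n * pochhammer B n * rGamma (D + of_nat n) / fact n"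

lemma gauss_term_eq:
  assumes "D \<notin> \<int>\<^sub>\<le>\<^sub>0"
  shows "gauss_term A B D n
           = rGamma D * (pochhammer A n * pochhammer B n / (pochhammer D n * fact n))"
proof -
  have "pochhammer D n \<noteq> 0"
    using assms pochhammer_eq_0_imp_nonpos_Int by blast
  then show ?thesis
    using pochhammer_rGamma[of D n] by (simp add: gauss_term_def)
qed

lemma gauss_term_estimates:
  assumes "D \<notin> \<int>\<^sub>\<le>\<^sub>0" and conv: "Re (D - A - B) > 0"
  shows gauss_term_abs_summable: "summable (\<lambda>n. norm (gauss_term A B D n))"
    and gauss_term_small: "(\<lambda>n. of_nat n * gauss_term A B D n) \<longlonglongrightarrow> 0"
proof -
  let ?\<sigma> = "Re (D - A - B)"
  obtain C where *: "\<And>n. n \<ge> 1 \<Longrightarrow> real (Suc n) * norm (pochhammer A (Suc n) * pochhammer B (Suc n)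
            / (pochhammer D (Suc n) * fact (Suc n))) \<le> C * real n powr (- ?\<sigma>)"
    using hypergeo_term_bound[OF assms(1), of A B] by blast
  then have C: "real (Suc n) * norm (gauss_term A B D (Suc n))
      \<le> norm (rGamma D) * C * real n powr (- ?\<sigma>)" if "n \<ge> 1" for n
  proof -
    have "real (Suc n) * norm (gauss_term A B D (Suc n)) = norm (rGamma D) * (real (Suc n) *
        norm (pochhammer A (Suc n) * pochhammer B (Suc n) / (pochhammer D (Suc n) * fact (Suc n))))"
      unfolding gauss_term_eq[OF assms(1)] norm_mult[of "rGamma D"] by (simp only: mult_ac)
    also have "\<dots> \<le> norm (rGamma D) * (C * real n powr (- ?\<sigma>))"
      using that by (intro mult_left_mono *) auto
    finally show ?thesis by (simp only: mult_ac)
  qed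
  let ?K = "norm (rGamma D) * C"
  have K: "?K \<ge> 0"
  proof -
    have "0 \<le> real (Suc 1) * norm (gauss_term A B D (Suc 1))" by simp
    also have "\<dots> \<le> ?K * real 1 powr (- ?\<sigma>)" by (rule C) simp
    finally show ?thesis by simp
  qed
  have "summable (\<lambda>n. ?K * real n powr (- ?\<sigma> - 1))"
    using conv by (intro summable_mult) (simp add: summable_real_powr_iff)
  moreover have "norm (norm (gauss_term A B D (Suc n))) \<le> ?K * real n powr (- ?\<sigma> - 1)"
    if n: "n \<ge> 1" for n
  proof -
    have "real n * norm (gauss_term A B D (Suc n)) \<le> real (Suc n) * norm (gauss_term A B D (Suc n))"
      by (intro mult_right_mono) auto
    also have "\<dots> \<le> ?K * real n powr (- ?\<sigma>)" by (rule C[OF n])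
    finally have "norm (gauss_term A B D (Suc n)) \<le> ?K * real n powr (- ?\<sigma>) / real n"
      using n by (simp add: pos_le_divide_eq mult.commute)
    then show ?thesis
      using n by (simp add: powr_diff pos_le_divide_eq mult_ac)
  qed
  ultimately have "summable (\<lambda>n. norm (gauss_term A B D (Suc n)))"
    by (rule summable_comparison_test'[where N = 1])
  then show "summable (\<lambda>n. norm (gauss_term A B D n))"
    by (subst (asm) summable_Suc_iff)
  have "(\<lambda>n. ?K * real n powr (- ?\<sigma>)) \<longlonglongrightarrow> ?K * 0"
    using conv by (intro tendsto_mult tendsto_const tendsto_neg_powr filterlim_real_sequentially) auto
  then have "(\<lambda>n. ?K * real n powr (- ?\<sigma>)) \<longlonglongrightarrow> 0" by simp
  moreover have "eventually (\<lambda>n. norm (of_nat (Suc n) * gauss_term A B D (Suc n))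
      \<le> ?K * real n powr (- ?\<sigma>)) sequentially"
    using eventually_ge_at_top[of 1] by eventually_elim (use C in \<open>simp only: norm_mult norm_of_nat\<close>)
  ultimately have "(\<lambda>n. of_nat (Suc n) * gauss_term A B D (Suc n)) \<longlonglongrightarrow> 0"
    by (rule Lim_null_comparison[rotated])
  then show "(\<lambda>n. of_nat n * gauss_term A B D n) \<longlonglongrightarrow> 0"
    by (rule LIMSEQ_imp_Suc)
qed

text \<open>
  With \<open>w n = n * gauss_term A B D n\<close>, the difference of the \<open>n\<close>-th terms of both sides is \<open>w n - w (Suc n)\<close>,
  so the difference of the sums telescopes to \<open>w 0 - lim w = 0\<close>.
\<close>
lemma gauss_contiguous:
  assumes D: "D \<notin> \<int>\<^sub>\<le>\<^sub>0" and conv: "Re (D - A - B) > 0"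
  shows "(D - A - B) * (\<Sum>n. gauss_term A B D n)
           = (D - A) * (D - B) * (\<Sum>n. gauss_term A B (D + 1) n)"
proof -
  have D1: "D + 1 \<notin> \<int>\<^sub>\<le>\<^sub>0" using not_nonpos_Int_add_nat[OF D, of 1] by simp
  have s0: "summable (gauss_term A B D)"
    using gauss_term_abs_summable[OF D conv] by (rule summable_norm_cancel)
  have s1: "summable (gauss_term A B (D + 1))"
    using gauss_term_abs_summable[OF D1, of A B] conv by (auto intro: summable_norm_cancel)
  define w where "w n = of_nat n * gauss_term A B D n" for n
  have v: "gauss_term A B D n = (D + of_nat n) * gauss_term A B (D + 1) n" for n
    using rGamma_plus1[of "D + of_nat n"] by (simp add: gauss_term_def add_ac)
  have step: "(D - A - B) * gauss_term A B D n - (D - A) * (D - B) * gauss_term A B (D + 1) n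
      = w n - w (Suc n)" for n
  proof -
    have "w (Suc n) = (A + of_nat n) * (B + of_nat n) * gauss_term A B (D + 1) n"
    proof -
      have nz: "of_nat (Suc n) \<noteq> (0 :: complex)" by (rule of_nat_neq_0)
      have "w (Suc n) = of_nat (Suc n) * (pochhammer A n * (A + of_nat n) * (pochhammer B n * (B + of_nat n))
               * rGamma (D + 1 + of_nat n) / (of_nat (Suc n) * fact n))"
        unfolding w_def gauss_term_def pochhammer_Suc fact_Suc by (simp only: of_nat_Suc add_ac)
      also have "\<dots> = pochhammer A n * (A + of_nat n) * (pochhammer B n * (B + of_nat n))
               * rGamma (D + 1 + of_nat n) / fact n"
        using nz by (simp del: of_nat_Suc)
      finally show ?thesis
        by (simp add: gauss_term_def mult_ac)
    qed
    then show ?thesis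
      unfolding w_def by (simp add: v algebra_simps)
  qed
  have "(\<lambda>n. w n - w (Suc n)) sums (w 0 - 0)"
    using gauss_term_small[OF D conv] unfolding w_def by (rule telescope_sums')
  then have "(\<lambda>n. (D - A - B) * gauss_term A B D n - (D - A) * (D - B) * gauss_term A B (D + 1) n)
      sums 0"
    by (simp only: step) (simp add: w_def)
  moreover have "(\<lambda>n. (D - A - B) * gauss_term A B D n - (D - A) * (D - B) * gauss_term A B (D + 1) n)
      sums ((D - A - B) * (\<Sum>n. gauss_term A B D n) - (D - A) * (D - B) * (\<Sum>n. gauss_term A B (D + 1) n))"
    using s0 s1 by (intro sums_diff sums_mult summable_sums)
  ultimately show ?thesis
    using sums_unique2 by fastforce
qed

lemma gauss_contiguous_iterated:
  assumes D: "D \<notin> \<int>\<^sub>\<le>\<^sub>0" and conv: "Re (D - A - B) > 0"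
  shows "pochhammer (D - A - B) N * (\<Sum>n. gauss_term A B D n)
           = pochhammer (D - A) N * pochhammer (D - B) N * (\<Sum>n. gauss_term A B (D + of_nat N) n)"
proof (induction N)
  case (Suc N)
  have "D + of_nat N \<notin> \<int>\<^sub>\<le>\<^sub>0" by (rule not_nonpos_Int_add_nat[OF D])
  from gauss_contiguous[OF this, of A B]
  have step: "(D - A - B + of_nat N) * (\<Sum>n. gauss_term A B (D + of_nat N) n)
     = (D - A + of_nat N) * (D - B + of_nat N) * (\<Sum>n. gauss_term A B (D + of_nat (Suc N)) n)"
    using conv by (simp add: algebra_simps)
  have "pochhammer (D - A - B) (Suc N) * (\<Sum>n. gauss_term A B D n)
      = (D - A - B + of_nat N) * (pochhammer (D - A - B) N * (\<Sum>n. gauss_term A B D n))"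
    by (simp only: pochhammer_Suc mult_ac)
  also have "\<dots> = pochhammer (D - A) N * pochhammer (D - B) N
      * ((D - A - B + of_nat N) * (\<Sum>n. gauss_term A B (D + of_nat N) n))"
    by (simp only: Suc.IH) (simp only: mult_ac)
  also have "\<dots> = pochhammer (D - A) (Suc N) * pochhammer (D - B) (Suc N)
      * (\<Sum>n. gauss_term A B (D + of_nat (Suc N)) n)"
    by (simp only: step pochhammer_Suc mult_ac)
  finally show ?case .
qed auto

lemma norm_pochhammer_le: "norm (pochhammer (z::complex) n) \<le> pochhammer (norm z) n"
proof (induction n)
  case (Suc n)
  have "norm (z + of_nat n) \<le> norm z + real n"
    by (rule order.trans[OF norm_triangle_ineq]) simp
  with Suc show ?case
    unfolding pochhammer_Suc norm_mult by (intro mult_mono) (auto simp: pochhammer_real_nonneg)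
qed auto

lemma norm_pochhammer_ge:
  assumes "0 < c" "c \<le> Re z"
  shows "pochhammer c n \<le> norm (pochhammer (z::complex) n)"
proof (induction n)
  case (Suc n)
  have "c + real n \<le> Re (z + of_nat n)" using assms by simp
  also have "\<dots> \<le> norm (z + of_nat n)" by (rule complex_Re_le_cmod)
  finally show ?case
    using Suc assms unfolding pochhammer_Suc norm_mult
    by (intro mult_mono) (auto intro: add_nonneg_nonneg)
qed auto

text \<open>
  For large lower parameter only the constant term survives, by dominated convergence for series. The
  domination needs a single convergent majorant: choose \<open>N\<^sub>0\<close> with \<open>c = Re D + N\<^sub>0 > norm A + norm B\<close> and
  compare with the series of positive terms at the parameters \<open>norm A\<close>, \<open>norm B\<close>, \<open>c\<close>, which converges
  by the same criterion.
\<close>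
lemma hypergeo_series_shift_tendsto_1:
  "(\<lambda>N. \<Sum>n. pochhammer A n * pochhammer B n / (pochhammer (D + of_nat N) n * fact n))
     \<longlonglongrightarrow> (1 :: complex)"
proof -
  obtain N0 :: nat where N0: "real N0 > norm A + norm B + \<bar>Re D\<bar>"
    using reals_Archimedean2 by blast
  define c where "c = Re D + real N0"
  have c: "c > norm A + norm B" "c > 0"
    using N0 norm_ge_zero[of A] norm_ge_zero[of B] unfolding c_def by linarith+
  let ?h = "\<lambda>n. pochhammer (norm A) n * pochhammer (norm B) n / (pochhammer c n * fact n)"
  have cn: "complex_of_real c \<notin> \<int>\<^sub>\<le>\<^sub>0"
    using c(2) nonpos_Ints_nonpos[of c] by (auto simp: of_real_in_nonpos_Ints_iff)
  have "summable (\<lambda>n. norm (gauss_term (of_real (norm A)) (of_real (norm B)) (of_real c) n))"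
    using c by (intro gauss_term_abs_summable cn) auto
  moreover have "norm (gauss_term (of_real (norm A)) (of_real (norm B)) (of_real c) n)
      = norm (rGamma (of_real c :: complex)) * ?h n" for n
  proof -
    have "gauss_term (of_real (norm A)) (of_real (norm B)) (of_real c) n
        = rGamma (of_real c) * of_real (?h n)"
      by (simp add: gauss_term_eq[OF cn] pochhammer_of_real)
    moreover have "?h n \<ge> 0"
      using c(2) by (intro divide_nonneg_nonneg mult_nonneg_nonneg pochhammer_real_nonneg) auto
    ultimately show ?thesis
      by (simp only: norm_mult norm_of_real abs_of_nonneg)
  qed
  moreover have "rGamma (of_real c :: complex) \<noteq> 0"
    using cn by (simp add: rGamma_eq_zero_iff)
  ultimately have sh: "summable ?h"
    by (simp only: summable_cmult_iff norm_eq_zero) blast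
  let ?t = "\<lambda>n N. pochhammer A n * pochhammer B n / (pochhammer (D + of_nat N) n * fact n)"
  have lim: "(\<lambda>N. ?t n N) \<longlonglongrightarrow> (if n = 0 then 1 else 0)" for n
  proof (cases n)
    case (Suc k)
    \<comment> \<open>One factor of \<open>pochhammer (D + N) n\<close> is split off: it grows with \<open>N\<close>, and the others stay above \<open>pochhammer c k\<close>.\<close>
    have bound: "norm (?t n N) \<le> norm (pochhammer A n * pochhammer B n)
        / (pochhammer c k * fact n) * inverse (c + real (N - N0))" if N: "N \<ge> N0" for N
    proof -
      have "pochhammer (c + real (N - N0)) n \<le> norm (pochhammer (D + of_nat N) n)"
        using c N by (intro norm_pochhammer_ge) (auto simp: c_def of_nat_diff)
      moreover have "pochhammer c k * (c + real (N - N0)) \<le> pochhammer (c + real (N - N0)) n"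
      proof -
        have "pochhammer c k \<le> pochhammer (c + real (N - N0) + 1) k"
          using c norm_pochhammer_ge[of c "of_real (c + real (N - N0) + 1)" k]
          by (simp add: pochhammer_of_real pochhammer_nonneg del: of_real_add)
        then show ?thesis
          using c unfolding Suc pochhammer_rec by (simp add: mult_ac mult_right_mono)
      qed
      ultimately have le: "pochhammer c k * (c + real (N - N0)) \<le> norm (pochhammer (D + of_nat N) n)"
        by linarith
      have pos: "pochhammer c k * (c + real (N - N0)) > 0"
        using c by (intro mult_pos_pos pochhammer_pos) auto
      have "norm (?t n N) = norm (pochhammer A n * pochhammer B n) / fact n
               / norm (pochhammer (D + of_nat N) n)"
        by (simp add: norm_divide norm_mult field_simps)
      also have "\<dots> \<le> norm (pochhammer A n * pochhammer B n) / fact n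
               / (pochhammer c k * (c + real (N - N0)))"
        by (intro divide_left_mono mult_pos_pos[OF order.strict_trans2[OF pos le] pos] le) auto
      finally show ?thesis by (simp add: field_simps)
    qed
    have "filterlim (\<lambda>N. c + real (N - N0)) at_top sequentially"
      by (intro filterlim_tendsto_add_at_top[OF tendsto_const]
                filterlim_compose[OF filterlim_real_sequentially] filterlim_minus_const_nat_at_top)
    then have "(\<lambda>N. inverse (c + real (N - N0))) \<longlonglongrightarrow> 0"
      by (rule tendsto_inverse_0_at_top)
    then have "(\<lambda>N. norm (pochhammer A n * pochhammer B n)
        / (pochhammer c k * fact n) * inverse (c + real (N - N0))) \<longlonglongrightarrow> 0"
      by (rule tendsto_mult_right_zero)
    moreover have "eventually (\<lambda>N. norm (?t n N) \<le> norm (pochhammer A n * pochhammer B n)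
        / (pochhammer c k * fact n) * inverse (c + real (N - N0))) sequentially"
      using eventually_ge_at_top[of N0] by eventually_elim (rule bound)
    ultimately show ?thesis
      using Suc by (auto intro: Lim_null_comparison[rotated])
  qed auto
  have dom: "norm (?t n N) \<le> ?h n" if "N \<ge> N0" for n N
  proof -
    have "pochhammer c n \<le> norm (pochhammer (D + of_nat N) n)"
      using c that by (intro norm_pochhammer_ge) (auto simp: c_def)
    then show ?thesis
      using c norm_pochhammer_le[of A n] norm_pochhammer_le[of B n]
      unfolding norm_divide norm_mult
      by (intro frac_le mult_mono mult_pos_pos mult_nonneg_nonneg pochhammer_pos pochhammer_real_nonneg)
         (auto simp: norm_mult)
  qed
  have "eventually (\<lambda>(n, N). norm (?t n N) \<le> ?h n) (at_top \<times>\<^sub>F sequentially)"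
    unfolding eventually_prod_filter using dom eventually_ge_at_top[of N0]
    by (intro exI[of _ "\<lambda>_. True"] exI[of _ "\<lambda>N. N \<ge> N0"]) auto
  then have "(\<lambda>N. \<Sum>n. ?t n N) \<longlonglongrightarrow> (\<Sum>n. if n = 0 then 1 else 0)"
    using tannerys_theorem[of "\<lambda>n N. ?t n N", OF lim _ sh] by simp
  also have "(\<Sum>n. if n = 0 then 1 else 0) = (1 :: complex)"
    using suminf_finite[of "{0}" "\<lambda>n. if n = 0 then 1 else (0::complex)"] by simp
  finally show ?thesis .
qed

text \<open>
  Gauss's theorem. The iterated contiguous relation expresses the sum through three Pochhammer symbols
  and the sum at \<open>D + N\<close>. As \<open>N\<close> grows, the last sum divided by its first term tends to \<open>1\<close>, and the Pochhammer
  symbols, in Euler's normalisation, tend to reciprocal Gamma values; the powers of \<open>N\<close> cancel because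
  \<open>(D - A) + (D - B) = (D - A - B) + D\<close>.
\<close>
theorem gauss_sum:
  assumes D: "D \<notin> \<int>\<^sub>\<le>\<^sub>0" and conv: "Re (D - A - B) > 0"
  shows "(\<Sum>n. gauss_term A B D n)
           = Gamma (D - A - B) * rGamma (D - A) * rGamma (D - B)"
proof -
  let ?S = "\<lambda>D. \<Sum>n. pochhammer A n * pochhammer B n / (pochhammer D n * fact n)"
  let ?E = "D - A - B"
  have E: "?E \<notin> \<int>\<^sub>\<le>\<^sub>0" using conv by (auto simp: complex_eq_iff elim!: nonpos_Ints_cases)
  have DN: "D + of_nat N \<notin> \<int>\<^sub>\<le>\<^sub>0" for N by (rule not_nonpos_Int_add_nat[OF D])
  have nz: "pochhammer D n \<noteq> 0" "pochhammer ?E n \<noteq> 0" for n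
    using D E pochhammer_eq_0_imp_nonpos_Int by blast+
  have shift: "(\<Sum>n. gauss_term A B (D + of_nat N) n) = rGamma D / pochhammer D N * ?S (D + of_nat N)" for N
  proof -
    have "summable (gauss_term A B (D + of_nat N))"
      using gauss_term_abs_summable[OF DN, of N A B] conv by (auto intro: summable_norm_cancel)
    moreover have "gauss_term A B (D + of_nat N) = (\<lambda>n. rGamma (D + of_nat N)
           * (pochhammer A n * pochhammer B n / (pochhammer (D + of_nat N) n * fact n)))"
      using gauss_term_eq[OF DN, of A B N] by (intro ext)
    moreover from DN[of N] have "rGamma (D + of_nat N) \<noteq> 0"
      by (simp add: rGamma_eq_zero_iff)
    ultimately have "suminf (gauss_term A B (D + of_nat N)) = rGamma (D + of_nat N) * ?S (D + of_nat N)"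
      using suminf_mult summable_mult_D by metis
    then show ?thesis
      using pochhammer_rGamma[of D N] nz by simp
  qed
  \<comment> \<open>The shift is by \<open>Suc N\<close> because \<open>rGamma_series z N\<close> contains \<open>pochhammer z (Suc N)\<close>.\<close>
  have eq: "(\<Sum>n. gauss_term A B D n) = rGamma_series (D - A) N * rGamma_series (D - B) N
      * Gamma_series ?E N * Gamma_series D N * rGamma D * ?S (D + of_nat (Suc N))" if N: "N \<ge> 1" for N
  proof -
    have "(\<Sum>n. gauss_term A B D n) = pochhammer (D - A) (Suc N) * pochhammer (D - B) (Suc N)
        / pochhammer ?E (Suc N) * (rGamma D / pochhammer D (Suc N) * ?S (D + of_nat (Suc N)))"
    proof -
      have "(\<Sum>n. gauss_term A B D n)
          = pochhammer ?E (Suc N) * (\<Sum>n. gauss_term A B D n) / pochhammer ?E (Suc N)"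
        using nz(2)[of "Suc N"] by simp
      then show ?thesis
        unfolding gauss_contiguous_iterated[OF D conv, of "Suc N"] shift by simp
    qed
    moreover have "exp ((D - A) * of_real (ln (of_nat N))) * exp ((D - B) * of_real (ln (of_nat N)))
      = exp (?E * of_real (ln (of_nat N))) * exp (D * of_real (ln (of_nat N)))"
      by (simp add: algebra_simps flip: exp_add)
    then have "Gamma_series ?E N * Gamma_series D N
        = fact N * fact N * (exp ((D - A) * of_real (ln (of_nat N))) * exp ((D - B) * of_real (ln (of_nat N))))
          / (pochhammer ?E (Suc N) * pochhammer D (Suc N))"
      by (simp add: Gamma_series_def)
    then have "rGamma_series (D - A) N * rGamma_series (D - B) N * (Gamma_series ?E N * Gamma_series D N)
       = pochhammer (D - A) (Suc N) * pochhammer (D - B) (Suc N) / (pochhammer ?E (Suc N) * pochhammer D (Suc N))"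
      by (simp add: rGamma_series_def)
    ultimately show ?thesis
      by (simp add: mult_ac)
  qed
  have "(\<lambda>N. rGamma_series (D - A) N * rGamma_series (D - B) N
      * Gamma_series ?E N * Gamma_series D N * rGamma D * ?S (D + of_nat (Suc N)))
      \<longlonglongrightarrow> rGamma (D - A) * rGamma (D - B) * Gamma ?E * Gamma D * rGamma D * 1"
    by (intro tendsto_intros LIMSEQ_Suc[OF hypergeo_series_shift_tendsto_1])
  moreover have "eventually (\<lambda>N. rGamma_series (D - A) N * rGamma_series (D - B) N
      * Gamma_series ?E N * Gamma_series D N * rGamma D * ?S (D + of_nat (Suc N))
      = (\<Sum>n. gauss_term A B D n)) sequentially"
    using eventually_ge_at_top[of 1] by eventually_elim (use eq in simp)
  ultimately have "rGamma (D - A) * rGamma (D - B) * Gamma ?E * Gamma D * rGamma D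
      = (\<Sum>n. gauss_term A B D n)"
    by (intro LIMSEQ_unique) (auto intro: tendsto_eventually simp: filterlim_cong)
  moreover have "Gamma D * rGamma D = 1"
    using D by (simp add: rGamma_inverse_Gamma Gamma_eq_zero_iff)
  ultimately show ?thesis
    by (metis (no_types, lifting) mult.assoc mult.commute mult_1_right)
qed

section \<open>The Beta integral with complex parameters\<close>

text \<open>
  The complex logarithm jumps across the negative half-line, but on the real axis it is a Borel function
  on each side of \<open>0\<close>.
\<close>
lemma borel_measurable_of_real_cpowr [measurable]:
  assumes [measurable]: "f \<in> borel_measurable M"
  shows "(\<lambda>x. complex_of_real (f x) powr z) \<in> borel_measurable M"
proof -
  have "complex_of_real y powr z = (if y > 0 then exp (z * of_real (ln y)) else if y = 0 then 0
          else (-1) powr z * exp (z * of_real (ln (- y))))" for y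
  proof -
    have pos: "complex_of_real y powr z = exp (z * of_real (ln y))" if "y > 0" for y
      using that by (simp add: powr_def Ln_of_real)
    show ?thesis
      using pos[of y] pos[of "- y"] powr_neg_real_complex[of "- y" z] by (auto simp: not_less)
  qed
  then show ?thesis by (subst measurable_cong) auto
qed

lemma beta_integral_real:
  assumes "x > 0" "y > (0::real)"
  shows "set_integrable lebesgue {0<..<1} (\<lambda>u. u powr (x - 1) * (1 - u) powr (y - 1))"
    and "(LINT u:{0<..<1}|lebesgue. u powr (x - 1) * (1 - u) powr (y - 1)) = Beta x y"
proof -
  have *: "((\<lambda>u. u powr (x - 1) * (1 - u) powr (y - 1)) has_integral Beta x y) {0<..<1}"
    using has_integral_Beta_real[OF assms] by (simp add: has_integral_Icc_iff_Ioo)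
  then show int: "set_integrable lebesgue {0<..<1} (\<lambda>u. u powr (x - 1) * (1 - u) powr (y - 1))"
    by (intro nonnegative_absolutely_integrable_1) auto
  from * show "(LINT u:{0<..<1}|lebesgue. u powr (x - 1) * (1 - u) powr (y - 1)) = Beta x y"
    using set_lebesgue_integral_eq_integral(2)[OF int] by (simp add: integral_unique)
qed

lemma norm_beta_integrand:
  assumes "u \<in> {0<..<1}"
  shows "norm (complex_of_real u powr (a - 1) * complex_of_real (1 - u) powr (b - 1))
           = u powr (Re a - 1) * (1 - u) powr (Re b - 1)"
  using assms by (simp add: norm_mult norm_powr_real_powr del: of_real_diff)

lemma beta_integrable_complex:
  fixes a b :: complex
  assumes "Re a > 0" "Re b > 0"
  shows "set_integrable lebesgue {0<..<1}
           (\<lambda>u. complex_of_real u powr (a - 1) * complex_of_real (1 - u) powr (b - 1))"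
proof (rule set_integrable_bound[OF beta_integral_real(1)[OF assms]])
  show "set_borel_measurable lebesgue {0<..<1}
      (\<lambda>u. complex_of_real u powr (a - 1) * complex_of_real (1 - u) powr (b - 1))"
    unfolding set_borel_measurable_def by (rule measurable_completion) (auto simp del: of_real_diff)
qed (auto simp: norm_beta_integrand simp del: of_real_diff)

definition gamma_integrand :: "complex \<Rightarrow> real \<Rightarrow> complex" where
  "gamma_integrand z t = indicator {0<..} t *\<^sub>R (of_real t powr (z - 1) * of_real (exp (- t)))"

lemma gamma_integrand_measurable [measurable]: "gamma_integrand z \<in> borel_measurable borel"
  unfolding gamma_integrand_def by measurable

lemma gamma_integrand_integral:
  assumes "Re z > 0"
  shows "integrable lborel (gamma_integrand z)" "integral\<^sup>L lborel (gamma_integrand z) = Gamma z"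
proof -
  have eq: "gamma_integrand z = (\<lambda>t. indicator {0<..} t *\<^sub>R (of_real t powr (z - 1) / of_real (exp t)))"
    by (auto simp: gamma_integrand_def fun_eq_iff exp_minus field_simps)
  have int: "set_integrable lebesgue {0<..} (\<lambda>t. complex_of_real t powr (z - 1) / of_real (exp t))"
    using absolutely_integrable_Gamma_integral'[OF assms] .
  then have "integrable lebesgue (gamma_integrand z)"
    unfolding set_integrable_def eq .
  then show "integrable lborel (gamma_integrand z)"
    by (subst (asm) integrable_completion) auto
  have "integral\<^sup>L lebesgue (gamma_integrand z) = (LINT t:{0<..}|lebesgue. complex_of_real t powr (z - 1) / of_real (exp t))"
    unfolding set_lebesgue_integral_def eq ..
  also have "\<dots> = Gamma z"
    using set_lebesgue_integral_eq_integral(2)[OF int] Gamma_integral_complex'[OF assms]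
    by (simp add: integral_unique)
  finally show "integral\<^sup>L lborel (gamma_integrand z) = Gamma z"
    by (subst (asm) integral_completion) auto
qed

text \<open>
  The complex version of Euler's Beta integral, by the classical convolution argument: integrate
  \<open>t powr (a - 1) * (u - t) powr (b - 1) * exp (- u)\<close> over \<open>0 < t < u\<close>. Integrating over \<open>u\<close> first (shift by \<open>t\<close>)
  gives \<open>Gamma a * Gamma b\<close>; integrating over \<open>t\<close> first (scaling by \<open>u\<close>) gives \<open>Gamma (a + b)\<close> times the
  Beta integral.
\<close>
theorem beta_integral_complex:
  fixes a b :: complex
  assumes a: "Re a > 0" and b: "Re b > 0"
  shows "(LINT u:{0<..<1}|lebesgue.
            complex_of_real u powr (a - 1) * complex_of_real (1 - u) powr (b - 1)) = Beta a b"
proof -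
  define I where "I = (LINT u:{0<..<1}|lborel.
            complex_of_real u powr (a - 1) * complex_of_real (1 - u) powr (b - 1))"
  define F where "F t u = (if 0 < t \<and> t < u then
     complex_of_real t powr (a - 1) * complex_of_real (u - t) powr (b - 1) * of_real (exp (- u)) else 0)"
    for t u :: real
  have [measurable]: "(\<lambda>(t, u). F t u) \<in> borel_measurable (lborel \<Otimes>\<^sub>M lborel)"
    unfolding F_def by measurable
  have [measurable]: "(\<lambda>t. F t u) \<in> borel_measurable lborel" "F t \<in> borel_measurable lborel" for t u
    unfolding F_def by measurable
  have shift: "F t (t + 1 * v) = gamma_integrand a t * gamma_integrand b v" for t v
    using exp_add[of "- t" "- v"]
    by (auto simp: F_def gamma_integrand_def indicator_def simp flip: of_real_mult)
  have F_int: "integrable lborel (F t)" for t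
    using lborel_integrable_real_affine_iff[of 1 "F t" t] gamma_integrand_integral(1)[OF b]
    by (simp only: shift) simp
  have "(\<integral>u. F t u \<partial>lborel) = gamma_integrand a t * Gamma b" for t
    using lborel_integral_real_affine[of 1 "F t" t] gamma_integrand_integral[OF b]
    by (simp only: shift) simp
  then have inner: "(\<lambda>t. \<integral>u. F t u \<partial>lborel) = (\<lambda>t. gamma_integrand a t * Gamma b)" by auto
  have inner_norm: "(\<integral>u. norm (F t u) \<partial>lborel) = norm (gamma_integrand a t) * (\<integral>v. norm (gamma_integrand b v) \<partial>lborel)" for t
    using lborel_integral_real_affine[of 1 "\<lambda>u. norm (F t u)" t]
    by (simp only: shift) (simp add: norm_mult)
  have int: "integrable (lborel \<Otimes>\<^sub>M lborel) (\<lambda>(t, u). F t u)"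
  proof (rule lborel_pair.Fubini_integrable)
    show "integrable lborel (\<lambda>t. \<integral>u. norm (case (t, u) of (t, u) \<Rightarrow> F t u) \<partial>lborel)"
      using gamma_integrand_integral(1)[OF a] by (simp add: inner_norm)
  qed (use F_int in auto)
  have scale: "F (0 + u * v) u = gamma_integrand (a + b) u * (indicator {0<..<1} v *\<^sub>R
      (complex_of_real v powr (a - 1) * complex_of_real (1 - v) powr (b - 1))) / of_real u" if "u > 0" for u v
  proof (cases "v \<in> {0<..<1}")
    case True
    have "of_real (u * v) powr (a - 1) = of_real u powr (a - 1) * of_real v powr (a - 1)"
      using True that by (simp add: powr_times_real)
    moreover have "of_real (u - u * v) powr (b - 1) = of_real u powr (b - 1) * of_real (1 - v) powr (b - 1)"
      using True that powr_times_real[of "of_real u" "of_real (1 - v)" "b - 1"]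
      by (simp add: algebra_simps)
    moreover have "complex_of_real u powr (a + b - 1)
        = of_real u * (of_real u powr (a - 1) * of_real u powr (b - 1))"
      using that by (simp add: powr_diff powr_add)
    ultimately show ?thesis
      using True that by (simp add: F_def gamma_integrand_def del: of_real_diff of_real_mult)
  next
    case False
    then show ?thesis using that by (auto simp: F_def zero_less_mult_iff)
  qed
  have outer: "(\<integral>t. F t u \<partial>lborel) = gamma_integrand (a + b) u * I" for u
  proof (cases "u > 0")
    case True
    then have "(\<integral>t. F t u \<partial>lborel) = u *\<^sub>R (\<integral>v. F (0 + u * v) u \<partial>lborel)"
      using lborel_integral_real_affine[of u "\<lambda>t. F t u" 0] by simp
    also have "\<dots> = gamma_integrand (a + b) u * I"
      unfolding scale[OF True] using True by (simp add: I_def set_lebesgue_integral_def scaleR_conv_of_real)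
    finally show ?thesis .
  next
    case False
    then have "(\<lambda>t. F t u) = (\<lambda>_. 0)" by (auto simp: F_def)
    then show ?thesis using False by (simp add: gamma_integrand_def)
  qed
  have "Gamma a * Gamma b = (\<integral>t. (\<integral>u. F t u \<partial>lborel) \<partial>lborel)"
    using gamma_integrand_integral[OF a] by (simp add: inner)
  also have "\<dots> = (\<integral>u. (\<integral>t. F t u \<partial>lborel) \<partial>lborel)"
    by (rule lborel_pair.Fubini_integral[OF int, symmetric])
  also have "\<dots> = Gamma (a + b) * I"
    using gamma_integrand_integral[of "a + b"] a b by (simp add: outer)
  finally have "Gamma a * Gamma b = Gamma (a + b) * I" .
  moreover have "Gamma (a + b) \<noteq> 0"
    using a b Re_pos_not_nonpos_Int[of "a + b"] by (simp add: Gamma_eq_zero_iff)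
  ultimately have "I = Beta a b"
    by (simp add: Beta_def field_simps)
  moreover have "I = (LINT u:{0<..<1}|lebesgue.
            complex_of_real u powr (a - 1) * complex_of_real (1 - u) powr (b - 1))"
    unfolding I_def set_lebesgue_integral_def
    by (subst integral_completion) (auto simp del: of_real_diff)
  ultimately show ?thesis by simp
qed

section \<open>Beta integrals of Gauss hypergeometric functions\<close>

text \<open>
  At an interior point the power series with coefficients \<open>gauss_term A B M n\<close> converges whatever
  the sign of \<open>Re (M - A - B)\<close>, by the ratio test: the quotient \<open>q n\<close> of consecutive terms tends to \<open>z\<close>.
\<close>
lemma gauss_series_summable:
  assumes M: "M \<notin> \<int>\<^sub>\<le>\<^sub>0" and z: "norm z < 1"
  shows "summable (\<lambda>n. norm (gauss_term A B M n * z ^ n))"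
proof -
  define q where "q n = (A + of_nat n) / of_nat n * ((B + of_nat n) / of_nat n)
      / ((M + of_nat n) / of_nat n * ((1 + of_nat n) / of_nat n)) * z" for n
  have quot: "(\<lambda>n. (w + of_nat n) / of_nat n) \<longlonglongrightarrow> 1" for w :: complex
  proof -
    have "(\<lambda>n. w / of_nat n + 1) \<longlonglongrightarrow> 0 + 1"
      by (intro tendsto_add tendsto_const lim_const_over_n)
    moreover have "eventually (\<lambda>n. w / of_nat n + 1 = (w + of_nat n) / of_nat n) sequentially"
      using eventually_gt_at_top[of 0] by eventually_elim (simp add: field_simps)
    ultimately show ?thesis by (simp add: filterlim_cong)
  qed
  have "q \<longlonglongrightarrow> 1 * 1 / (1 * 1) * z"
    unfolding q_def by (intro tendsto_intros quot) auto
  then have "(\<lambda>n. norm (q n)) \<longlonglongrightarrow> norm z"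
    using tendsto_norm by fastforce
  then have "eventually (\<lambda>n. norm (q n) < (1 + norm z) / 2) sequentially"
    using z by (intro order_tendstoD(2)) auto
  then have "eventually (\<lambda>n. norm (q n) < (1 + norm z) / 2 \<and> n > 0) sequentially"
    using eventually_gt_at_top[of 0] by (rule eventually_conj)
  then obtain N where N: "\<And>n. n \<ge> N \<Longrightarrow> norm (q n) < (1 + norm z) / 2 \<and> n > 0"
    unfolding eventually_sequentially by auto
  show ?thesis
  proof (rule summable_ratio_test)
    show "(1 + norm z) / 2 < 1" using z by simp
    fix n assume n: "n \<ge> N"
    have Mn: "M + of_nat n \<noteq> 0" using M plus_of_nat_eq_0_imp by blast
    have n0: "of_nat (Suc n) \<noteq> (0 :: complex)" "of_nat n \<noteq> (0 :: complex)" using N[OF n] of_nat_neq_0[of n] by auto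
    have q: "q n = (A + of_nat n) * (B + of_nat n) / ((M + of_nat n) * of_nat (Suc n)) * z"
      using n0 by (simp add: q_def of_nat_Suc[symmetric] del: of_nat_Suc)
    have rG: "rGamma (M + of_nat (Suc n)) = rGamma (M + of_nat n) / (M + of_nat n)"
      using rGamma_plus1[of "M + of_nat n"] Mn by (simp add: field_simps)
    have step: "gauss_term A B M (Suc n) * z ^ Suc n = q n * (gauss_term A B M n * z ^ n)"
      unfolding q gauss_term_def rG pochhammer_Suc fact_Suc power_Suc by (simp add: mult_ac)
    have "norm (q n) \<le> (1 + norm z) / 2" using N[OF n] by simp
    then show "norm (norm (gauss_term A B M (Suc n) * z ^ Suc n))
        \<le> (1 + norm z) / 2 * norm (norm (gauss_term A B M n * z ^ n))"
      unfolding step norm_mult[of "q n"] by (simp only: real_norm_def abs_mult abs_norm_cancel mult_right_mono norm_ge_zero)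
  qed
qed

text \<open>
  The function \<open>u powr (c - 1) * (1 - u) powr (M - 1) * \<^sub>2F\<^sub>1(A, B; M; 1 - u) / Gamma M\<close>.
\<close>
definition euler_kernel :: "complex \<Rightarrow> complex \<Rightarrow> complex \<Rightarrow> complex \<Rightarrow> real \<Rightarrow> complex" where
  "euler_kernel A B M c u = (\<Sum>n. gauss_term A B M n * of_real (1 - u) ^ n)
     * (of_real u powr (c - 1) * of_real (1 - u) powr (M - 1))"

lemma of_real_powr_add_nat:
  assumes "x > 0"
  shows "complex_of_real x powr (z + of_nat n) = of_real x powr z * of_real x ^ n"
  using assms by (simp add: powr_add powr_nat)

text \<open>
  Integrating the series term by term turns the factor \<open>rGamma (M + n)\<close> into \<open>rGamma (c + M + n)\<close> through the
  Beta integral, so the result is a Gauss sum with lower parameter \<open>c + M\<close>. The same computation with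
  absolute values yields absolute integrability and so replaces any knowledge of how
  the hypergeometric function behaves at \<open>1\<close>, that is, at the endpoint \<open>u = 0\<close>: the norms integrate to at most
  a constant times the norms of the terms of the Gauss series with lower parameter \<open>Re (c + M)\<close>, because
  \<open>pochhammer (Re M) n\<close> does not exceed the norm of \<open>pochhammer M n\<close>.
\<close>
theorem euler_kernel_integral:
  assumes M: "Re M > 0" and c: "Re c > 0" and conv: "Re (c + M - A - B) > 0"
  shows "set_integrable lebesgue {0<..<1} (euler_kernel A B M c)"
    and "(LINT u:{0<..<1}|lebesgue. euler_kernel A B M c u)
           = Gamma c * Gamma (c + M - A - B) * rGamma (c + M - A) * rGamma (c + M - B)"
proof -
  let ?b = "\<lambda>n u. complex_of_real u powr (c - 1) * complex_of_real (1 - u) powr (M + of_nat n - 1)"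
  define T where "T n u = indicator {0<..<1} u *\<^sub>R (gauss_term A B M n * ?b n u)" for n and u :: real
  have ReM: "Re (M + of_nat n) > 0" for n using M by simp
  have T_int: "integrable lebesgue (T n)" for n
    using beta_integrable_complex[OF c ReM, of n]
    unfolding T_def set_integrable_def by (simp add: scaleR_conv_of_real mult.left_commute)
  have T_eq: "T n u = indicator {0<..<1} u *\<^sub>R (gauss_term A B M n * of_real (1 - u) ^ n
      * (of_real u powr (c - 1) * of_real (1 - u) powr (M - 1)))" for n u
  proof (cases "u \<in> {0<..<1}")
    case True
    have "M + of_nat n - 1 = M - 1 + of_nat n" by simp
    then have "complex_of_real (1 - u) powr (M + of_nat n - 1) = of_real (1 - u) powr (M - 1) * of_real (1 - u) ^ n"
      using True of_real_powr_add_nat[of "1 - u" "M - 1" n] by (simp only: greaterThanLessThan_iff diff_gt_0_iff_gt)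
    then show ?thesis
      unfolding T_def by (simp only: mult_ac)
  qed (simp add: T_def)
  have T_sum: "summable (\<lambda>n. norm (T n u))" for u
  proof (cases "u \<in> {0<..<1}")
    case True
    then have "summable (\<lambda>n. norm (gauss_term A B M n * of_real (1 - u) ^ n))"
      using M by (intro gauss_series_summable Re_pos_not_nonpos_Int) (auto simp flip: of_real_diff)
    then show ?thesis
      using True unfolding T_eq norm_mult norm_scaleR by (simp add: mult.assoc[symmetric] summable_mult2)
  qed (simp add: T_def)
  have T_suminf: "(\<Sum>n. T n u) = indicator {0<..<1} u *\<^sub>R euler_kernel A B M c u" for u
  proof (cases "u \<in> {0<..<1}")
    case True
    then have "summable (\<lambda>n. norm (gauss_term A B M n * of_real (1 - u) ^ n))"
      using M by (intro gauss_series_summable Re_pos_not_nonpos_Int) (auto simp flip: of_real_diff)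
    then have "summable (\<lambda>n. gauss_term A B M n * of_real (1 - u) ^ n)"
      by (rule summable_norm_cancel)
    from suminf_mult2[OF this] True show ?thesis
      by (simp add: T_eq euler_kernel_def)
  qed (simp add: T_def)
  have T_integral: "integral\<^sup>L lebesgue (T n) = Gamma c * gauss_term A B (c + M) n" for n
  proof -
    have "integral\<^sup>L lebesgue (T n) = gauss_term A B M n * Beta c (M + of_nat n)"
      using beta_integral_complex[OF c ReM, of n]
      unfolding T_def set_lebesgue_integral_def by (simp add: scaleR_conv_of_real mult.left_commute)
    also have "\<dots> = Gamma c * gauss_term A B (c + M) n * (rGamma (M + of_nat n) * Gamma (M + of_nat n))"
      by (simp add: gauss_term_def Beta_altdef add_ac)
    also have "rGamma (M + of_nat n) * Gamma (M + of_nat n) = 1"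
      using Re_pos_not_nonpos_Int[OF ReM[of n]] by (simp add: rGamma_inverse_Gamma Gamma_eq_zero_iff)
    finally show ?thesis by simp
  qed
  let ?R = "complex_of_real (Re (c + M))"
  have Rpos: "Re (c + M) > 0" using c M by simp
  have T_norm: "(\<integral>u. norm (T n u) \<partial>lebesgue)
      \<le> norm (rGamma M) * Gamma (Re M) * Gamma (Re c) * norm (gauss_term A B ?R n)" for n
  proof -
    have "(\<integral>u. norm (T n u) \<partial>lebesgue) = (LINT u:{0<..<1}|lebesgue.
        norm (gauss_term A B M n) * (u powr (Re c - 1) * (1 - u) powr (Re (M + of_nat n) - 1)))"
      unfolding set_lebesgue_integral_def T_def
      by (intro Bochner_Integration.integral_cong refl)
         (auto simp: indicator_def norm_mult norm_powr_real_powr simp del: of_real_diff)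
    also have "\<dots> = norm (gauss_term A B M n) * Beta (Re c) (Re M + real n)"
      using beta_integral_real(2)[OF c ReM, of n] by simp
    also have "\<dots> = (Gamma (Re c) * norm (gauss_term A B ?R n))
        * (norm (rGamma (M + of_nat n)) * Gamma (Re M + real n))"
    proof -
      have "?R + of_nat n = of_real (Re (c + M) + real n)" by simp
      then have "norm (rGamma (?R + of_nat n)) = \<bar>rGamma (Re (c + M) + real n)\<bar>"
        by (metis norm_of_real rGamma_complex_of_real)
      moreover have "rGamma (Re (c + M) + real n) \<ge> 0"
        using Rpos by (simp add: rGamma_inverse_Gamma Gamma_real_nonneg)
      ultimately show ?thesis
        by (simp add: gauss_term_def norm_mult norm_divide Beta_altdef add_ac)
    qed
    also have "\<dots> \<le> (Gamma (Re c) * norm (gauss_term A B ?R n)) * (norm (rGamma M) * Gamma (Re M))"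
    proof (rule mult_left_mono)
      have p: "pochhammer (Re M) n \<le> norm (pochhammer M n)"
        using M by (intro norm_pochhammer_ge) auto
      have p0: "pochhammer (Re M) n > 0" using M by (intro pochhammer_pos)
      have "Re M \<notin> \<int>\<^sub>\<le>\<^sub>0" using M by auto
      then have "Gamma (Re M + real n) = pochhammer (Re M) n * Gamma (Re M)"
        using Gamma_real_pos[OF M] pochhammer_Gamma[of "Re M" n] by (simp add: field_simps)
      also have "norm (rGamma (M + of_nat n)) * (pochhammer (Re M) n * Gamma (Re M))
          \<le> norm (rGamma (M + of_nat n)) * (norm (pochhammer M n) * Gamma (Re M))"
        using p Gamma_real_pos[OF M] by (intro mult_left_mono mult_right_mono) auto
      also have "\<dots> = norm (rGamma M) * Gamma (Re M)"
        using pochhammer_rGamma[of M n] by (simp add: norm_mult)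
      finally show "norm (rGamma (M + of_nat n)) * Gamma (Re M + real n) \<le> norm (rGamma M) * Gamma (Re M)"
        by simp
    qed (use Gamma_real_pos[OF c] in simp)
    finally show ?thesis
      by (simp only: mult_ac)
  qed
  have "summable (\<lambda>n. norm (gauss_term A B ?R n))"
    using Rpos conv by (intro gauss_term_abs_summable Re_pos_not_nonpos_Int) auto
  then have norms: "summable (\<lambda>n. \<integral>u. norm (T n u) \<partial>lebesgue)"
  proof (rule summable_comparison_test'[OF summable_mult])
    show "norm (\<integral>u. norm (T n u) \<partial>lebesgue)
        \<le> norm (rGamma M) * Gamma (Re M) * Gamma (Re c) * norm (gauss_term A B ?R n)" if "n \<ge> 0" for n
      using T_norm[of n] by (subst real_norm_def, subst abs_of_nonneg) (auto intro: integral_nonneg_AE)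
  qed
  show "set_integrable lebesgue {0<..<1} (euler_kernel A B M c)"
    using integrable_suminf[OF T_int _ norms] T_sum
    unfolding set_integrable_def T_suminf by simp
  have "(LINT u:{0<..<1}|lebesgue. euler_kernel A B M c u) = (\<Sum>n. integral\<^sup>L lebesgue (T n))"
    using integral_suminf[OF T_int _ norms] T_sum
    unfolding set_lebesgue_integral_def T_suminf by simp
  also have "\<dots> = Gamma c * (\<Sum>n. gauss_term A B (c + M) n)"
    unfolding T_integral using c M conv
    by (intro suminf_mult summable_norm_cancel[OF gauss_term_abs_summable] Re_pos_not_nonpos_Int) auto
  also have "\<dots> = Gamma c * Gamma (c + M - A - B) * rGamma (c + M - A) * rGamma (c + M - B)"
    using c M conv Re_pos_not_nonpos_Int[of "c + M"] by (subst gauss_sum) auto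
  finally show "(LINT u:{0<..<1}|lebesgue. euler_kernel A B M c u)
           = Gamma c * Gamma (c + M - A - B) * rGamma (c + M - A) * rGamma (c + M - B)" .
qed

text \<open>
  The \<open>n\<close>-th term of the exponential series contributes a power \<open>u powr (n / \<nu>)\<close>, which only shifts \<open>c\<close> to
  \<open>c + n / \<nu>\<close>. The integrals of the terms are therefore known, and they are the terms of the Fox-Wright
  series. Since \<open>u powr (n / \<nu>) \<le> 1\<close>, the exponential series of \<open>norm z\<close> dominates.
\<close>
theorem euler_kernel_exp_integral:
  fixes A B M c z :: complex and \<nu> :: real
  assumes M: "Re M > 0" and c: "Re c > 0" and conv: "Re (c + M - A - B) > 0" and nu: "\<nu> > 0"
  shows "set_integrable lebesgue {0<..<1}
           (\<lambda>u. euler_kernel A B M c u * exp (z * of_real (u powr (1 / \<nu>))))"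
    and "(LINT u:{0<..<1}|lebesgue. euler_kernel A B M c u * exp (z * of_real (u powr (1 / \<nu>))))
           = fox_wright [(c, 1 / \<nu>), (c + M - A - B, 1 / \<nu>)]
                        [(c + M - A, 1 / \<nu>), (c + M - B, 1 / \<nu>)] z"
proof -
  let ?e = "euler_kernel A B M"
  define T where "T n u = indicator {0<..<1} u *\<^sub>R (z ^ n / fact n * ?e (c + of_real (1 / \<nu>) * of_nat n) u)"
    for n and u :: real
  have cn: "Re (c + of_real (1 / \<nu>) * of_nat n) > 0"
      "Re (c + of_real (1 / \<nu>) * of_nat n + M - A - B) > 0" for n
  proof -
    have "real n / \<nu> \<ge> 0" using nu by simp
    then show "Re (c + of_real (1 / \<nu>) * of_nat n) > 0"
      "Re (c + of_real (1 / \<nu>) * of_nat n + M - A - B) > 0" using c conv by auto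
  qed
  have T_int: "integrable lebesgue (T n)" for n
    using euler_kernel_integral(1)[OF M cn, of n]
    unfolding T_def set_integrable_def by (simp add: scaleR_conv_of_real mult.left_commute)
  have T_eq: "T n u = indicator {0<..<1} u *\<^sub>R (?e c u * ((z * of_real (u powr (1 / \<nu>))) ^ n / fact n))"
    for n u
  proof (cases "u \<in> {0<..<1}")
    case True
    have "complex_of_real (u powr (1 / \<nu>)) ^ n = complex_of_real (u powr (1 / \<nu> * real n))"
      using True by (simp only: of_real_power[symmetric] powr_powr[symmetric])
                    (simp add: powr_realpow)
    also have "\<dots> = of_real u powr of_real (1 / \<nu> * real n)"
      using True by (intro powr_of_real[symmetric]) auto
    finally have pow: "complex_of_real (u powr (1 / \<nu>)) ^ n = of_real u powr (of_real (1 / \<nu>) * of_nat n)"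
      by (simp only: of_real_mult of_real_of_nat_eq)
    have "c + of_real (1 / \<nu>) * of_nat n - 1 = c - 1 + of_real (1 / \<nu>) * of_nat n" by simp
    then have split: "of_real u powr (c + of_real (1 / \<nu>) * of_nat n - 1)
        = of_real u powr (c - 1) * of_real (u powr (1 / \<nu>)) ^ n"
      by (simp only: powr_add pow)
    then show ?thesis
      unfolding T_def euler_kernel_def split power_mult_distrib
      by (simp only: times_divide_eq_left times_divide_eq_right mult_ac)
  qed (simp add: T_def)
  have exps: "(\<lambda>n. w ^ n / fact n) sums exp w" for w :: complex
    using exp_converges[of w] by (simp add: scaleR_conv_of_real divide_inverse mult.commute)
  have abs_exps: "summable (\<lambda>n. norm (w ^ n / fact n))" for w :: complex
    using summable_norm_exp[of w] by (simp add: norm_mult norm_divide divide_inverse norm_inverse mult.commute)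
  have T_sum: "summable (\<lambda>n. norm (T n u))" for u
    unfolding T_eq norm_scaleR norm_mult[of "?e c u"] by (intro summable_mult abs_exps)
  have T_suminf: "(\<Sum>n. T n u) = indicator {0<..<1} u *\<^sub>R (?e c u * exp (z * of_real (u powr (1 / \<nu>))))" for u
    unfolding T_eq by (intro sums_unique[symmetric] sums_scaleR_right sums_mult exps)
  have T_norm: "(\<integral>u. norm (T n u) \<partial>lebesgue)
      \<le> norm (z ^ n / fact n) * (\<integral>u. norm (indicator {0<..<1} u *\<^sub>R ?e c u) \<partial>lebesgue)" for n
  proof -
    have "(\<integral>u. norm (T n u) \<partial>lebesgue)
        \<le> (\<integral>u. norm (z ^ n / fact n) * norm (indicator {0<..<1} u *\<^sub>R ?e c u) \<partial>lebesgue)"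
    proof (rule integral_mono)
      show "integrable lebesgue (\<lambda>u. norm (z ^ n / fact n) * norm (indicator {0<..<1} u *\<^sub>R ?e c u))"
        using euler_kernel_integral(1)[OF M c conv] unfolding set_integrable_def
        by (intro integrable_mult_right integrable_norm)
      fix u :: real
      show "norm (T n u) \<le> norm (z ^ n / fact n) * norm (indicator {0<..<1} u *\<^sub>R ?e c u)"
      proof (cases "u \<in> {0<..<1}")
        case True
        have "norm (T n u) = norm (z ^ n / fact n) * norm (?e c u) * (u powr (1 / \<nu>)) ^ n"
          using True by (simp add: T_eq norm_mult norm_divide norm_power power_mult_distrib)
        also have "\<dots> \<le> norm (z ^ n / fact n) * norm (?e c u) * 1"
          using True nu by (intro mult_left_mono power_le_one powr_le1 mult_nonneg_nonneg) auto
        finally show ?thesis using True by simp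
      qed (simp add: T_def)
    qed (use T_int in auto)
    then show ?thesis by (simp only: integral_mult_right_zero)
  qed
  have norms: "summable (\<lambda>n. \<integral>u. norm (T n u) \<partial>lebesgue)"
  proof (rule summable_comparison_test'[OF summable_mult2[OF abs_exps[of z]]])
    show "norm (\<integral>u. norm (T n u) \<partial>lebesgue)
        \<le> norm (z ^ n / fact n) * (\<integral>u. norm (indicator {0<..<1} u *\<^sub>R ?e c u) \<partial>lebesgue)"
      if "n \<ge> 0" for n
      using T_norm[of n] by (subst real_norm_def, subst abs_of_nonneg) (auto intro: integral_nonneg_AE)
  qed
  show "set_integrable lebesgue {0<..<1} (\<lambda>u. ?e c u * exp (z * of_real (u powr (1 / \<nu>))))"
    using integrable_suminf[OF T_int _ norms] T_sum
    unfolding set_integrable_def T_suminf by simp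
  have "(LINT u:{0<..<1}|lebesgue. ?e c u * exp (z * of_real (u powr (1 / \<nu>))))
      = (\<Sum>n. integral\<^sup>L lebesgue (T n))"
    using integral_suminf[OF T_int _ norms] T_sum
    unfolding set_lebesgue_integral_def T_suminf by simp
  also have "\<dots> = fox_wright [(c, 1 / \<nu>), (c + M - A - B, 1 / \<nu>)]
                        [(c + M - A, 1 / \<nu>), (c + M - B, 1 / \<nu>)] z"
    unfolding fox_wright_def
  proof (intro suminf_cong)
    fix n
    define w where "w = complex_of_real (1 / \<nu>) * of_nat n"
    have w: "c + w + M - A - B = c + M - A - B + w" "c + w + M - A = c + M - A + w"
      "c + w + M - B = c + M - B + w" by simp_all
    have "integral\<^sup>L lebesgue (T n) = z ^ n / fact n * (LINT u:{0<..<1}|lebesgue. ?e (c + w) u)"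
      unfolding T_def set_lebesgue_integral_def w_def by (simp add: scaleR_conv_of_real mult.left_commute)
    also have "\<dots> = z ^ n / fact n *
        (Gamma (c + w) * Gamma (c + w + M - A - B) * rGamma (c + w + M - A) * rGamma (c + w + M - B))"
      unfolding w_def euler_kernel_integral(2)[OF M cn] ..
    also have "\<dots> = Gamma (c + w) * Gamma (c + M - A - B + w)
        * (rGamma (c + M - A + w) * rGamma (c + M - B + w)) * z ^ n / fact n"
      by (subst w(1), subst w(2), subst w(3)) (simp only: times_divide_eq_left times_divide_eq_right mult_ac)
    finally show "integral\<^sup>L lebesgue (T n) =
        (\<Prod>(a, \<alpha>)\<leftarrow>[(c, 1 / \<nu>), (c + M - A - B, 1 / \<nu>)]. Gamma (a + of_real \<alpha> * of_nat n))
        * (\<Prod>(b, \<beta>)\<leftarrow>[(c + M - A, 1 / \<nu>), (c + M - B, 1 / \<nu>)]. rGamma (b + of_real \<beta> * of_nat n))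
        * z ^ n / fact n"
      unfolding w_def by (simp only: list.map prod_list.Cons prod_list.Nil case_prod_conv mult_1_right)
  qed
  finally show "(LINT u:{0<..<1}|lebesgue. ?e c u * exp (z * of_real (u powr (1 / \<nu>))))
      = fox_wright [(c, 1 / \<nu>), (c + M - A - B, 1 / \<nu>)]
                        [(c + M - A, 1 / \<nu>), (c + M - B, 1 / \<nu>)] z" .
qed

section \<open>Hypergeometric functions with natural parameter differences\<close>

lemma mult_falling_factorial:
  "n * (fact k * (n choose k)) = fact (Suc k) * (n choose Suc k) + k * (fact k * (n choose k))"
proof (cases "k \<le> n")
  case True
  have "Suc k * (n choose Suc k) = (n - k) * (n choose k)"
    using binomial_absorb_comp[of n k] binomial_absorption[of k n] by simp
  then have "fact (Suc k) * (n choose Suc k) = fact k * ((n - k) * (n choose k))"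
    by (simp only: fact_Suc of_nat_id mult.assoc mult.left_commute[of "Suc k"])
  moreover have "n * x = (n - k) * x + k * x" for x
    using True by (simp flip: add_mult_distrib)
  ultimately show ?thesis
    by (simp only: mult.left_commute[of "fact k"])
qed (simp add: binomial_eq_0)

lemma power_eq_sum_Stirling_falling:
  "n ^ j = (\<Sum>k\<le>j. Stirling j k * (fact k * (n choose k)))"
proof (induction j)
  case (Suc j)
  let ?f = "\<lambda>k. fact k * (n choose k)"
  have shift: "(\<Sum>k\<le>j. k * Stirling j k * ?f k) = (\<Sum>k\<le>j. Suc k * Stirling j (Suc k) * ?f (Suc k))"
    using sum.atMost_Suc_shift[of "\<lambda>k. k * Stirling j k * ?f k" j] by simp
  have "n ^ Suc j = (\<Sum>k\<le>j. Stirling j k * (n * ?f k))"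
    by (simp add: Suc sum_distrib_left mult_ac)
  also have "\<dots> = (\<Sum>k\<le>j. Stirling j k * ?f (Suc k)) + (\<Sum>k\<le>j. k * Stirling j k * ?f k)"
    unfolding mult_falling_factorial[of n] by (simp add: sum.distrib[symmetric] algebra_simps del: fact_Suc)
  also have "\<dots> = (\<Sum>k\<le>j. Stirling (Suc j) (Suc k) * ?f (Suc k))"
    unfolding shift by (simp add: sum.distrib[symmetric] algebra_simps del: fact_Suc)
  also have "\<dots> = (\<Sum>k\<le>Suc j. Stirling (Suc j) k * ?f k)"
    unfolding sum.atMost_Suc_shift by simp
  finally show ?case .
qed simp

text \<open>
  The numbers \<open>coeff_A\<close> are the coefficients of the polynomial \<open>\<Prod>j. pochhammer (f j + x) (ms j)\<close> in the basis of
  falling factorials \<open>x * (x - 1) * \<dots> * (x - k + 1)\<close>; at \<open>x = n\<close> these are \<open>fact k * (n choose k)\<close>.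
\<close>
lemma shift_poly_falling_expansion:
  assumes "m = (\<Sum>j=1..r. ms j)"
  shows "(\<Prod>j=1..r. pochhammer (f j + of_nat n) (ms j))
           = (\<Sum>k=0..m. coeff_A r f ms k * of_nat (fact k * (n choose k)))"
proof -
  let ?s = "\<lambda>j. sigma r f ms (m - j)" and ?f = "\<lambda>k. of_nat (fact k * (n choose k)) :: complex"
  have "(\<Prod>j=1..r. pochhammer (f j + of_nat n) (ms j)) = (\<Sum>j=0..m. ?s j * of_nat n ^ j)"
    unfolding assms by (rule sigma_identity)
  also have "\<dots> = (\<Sum>j=0..m. \<Sum>k=0..m. of_nat (Stirling j k) * ?s j * ?f k)"
  proof (rule sum.cong[OF refl])
    fix j assume j: "j \<in> {0..m}"
    have "of_nat n ^ j = (of_nat (n ^ j) :: complex)" by simp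
    also have "\<dots> = (\<Sum>k\<le>j. of_nat (Stirling j k) * ?f k)"
      unfolding power_eq_sum_Stirling_falling[of n j] of_nat_sum of_nat_mult ..
    also have "\<dots> = (\<Sum>k=0..m. of_nat (Stirling j k) * ?f k)"
      using j by (intro sum.mono_neutral_left) auto
    finally show "?s j * of_nat n ^ j = (\<Sum>k=0..m. of_nat (Stirling j k) * ?s j * ?f k)"
      by (simp only: sum_distrib_left mult_ac)
  qed
  also have "\<dots> = (\<Sum>k=0..m. \<Sum>j=0..m. of_nat (Stirling j k) * ?s j * ?f k)"
    by (rule sum.swap)
  also have "\<dots> = (\<Sum>k=0..m. coeff_A r f ms k * ?f k)"
  proof (rule sum.cong[OF refl])
    fix k assume "k \<in> {0..m}"
    have "(\<Sum>j=0..m. of_nat (Stirling j k) * ?s j * ?f k) = (\<Sum>j=k..m. of_nat (Stirling j k) * ?s j * ?f k)"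
      by (intro sum.mono_neutral_right) auto
    then show "(\<Sum>j=0..m. of_nat (Stirling j k) * ?s j * ?f k) = coeff_A r f ms k * ?f k"
      by (simp only: coeff_A_def assms[symmetric] sum_distrib_right)
  qed
  finally show ?thesis .
qed

lemma coeff_A_0: "coeff_A r f ms 0 = (\<Prod>j=1..r. pochhammer (f j) (ms j))"
proof -
  have "(\<Prod>j=1..r. pochhammer (f j) (ms j))
      = (\<Sum>k=0..(\<Sum>j=1..r. ms j). coeff_A r f ms k * of_nat (fact k * (0 choose k)))"
    using shift_poly_falling_expansion[OF refl, where n = 0] by simp
  also have "\<dots> = (\<Sum>k\<in>{0}. coeff_A r f ms k * of_nat (fact k * (0 choose k)))"
    by (intro sum.mono_neutral_right) (auto simp: binomial_eq_0)
  finally show ?thesis by simp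
qed

text \<open>
  Since \<open>pochhammer (f + m) n / pochhammer f n = pochhammer (f + n) m / pochhammer f m\<close>, upper and lower
  parameters that differ by a natural number contribute a polynomial in the summation index.
\<close>
lemma prod_pochhammer_shift:
  assumes "\<forall>j\<in>{1..r}. f j \<notin> \<int>\<^sub>\<le>\<^sub>0" and "m = (\<Sum>j=1..r. ms j)"
  shows "(\<Prod>j=1..r. pochhammer (f j + of_nat (ms j)) n) / (\<Prod>j=1..r. pochhammer (f j) n)
           = (\<Sum>k=0..m. coeff_A r f ms k / coeff_A r f ms 0 * of_nat (fact k * (n choose k)))"
proof -
  have nz: "pochhammer (f j) i \<noteq> 0" if "j \<in> {1..r}" for i j
    using assms that pochhammer_eq_0_imp_nonpos_Int by blast
  have "(\<Prod>j=1..r. pochhammer (f j + of_nat (ms j)) n) / (\<Prod>j=1..r. pochhammer (f j) n)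
      = (\<Prod>j=1..r. pochhammer (f j + of_nat n) (ms j)) / (\<Prod>j=1..r. pochhammer (f j) (ms j))"
    unfolding prod_dividef[symmetric]
  proof (rule prod.cong[OF refl])
    fix j assume j: "j \<in> {1..r}"
    have "pochhammer (f j) (ms j) * pochhammer (f j + of_nat (ms j)) n
        = pochhammer (f j) n * pochhammer (f j + of_nat n) (ms j)"
      by (metis add.commute pochhammer_product')
    then show "pochhammer (f j + of_nat (ms j)) n / pochhammer (f j) n
        = pochhammer (f j + of_nat n) (ms j) / pochhammer (f j) (ms j)"
      using nz[OF j] by (simp add: field_simps)
  qed
  also have "\<dots> = (\<Sum>k=0..m. coeff_A r f ms k * of_nat (fact k * (n choose k))) / coeff_A r f ms 0"
    by (simp only: shift_poly_falling_expansion[OF assms(2)] coeff_A_0)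
  finally show ?thesis
    by (simp only: sum_divide_distrib times_divide_eq_left)
qed

lemma foldr_mult_eq_prod_list:
  "foldr (\<lambda>a r. r * g a) as v = prod_list (map g as) * (v :: 'a :: comm_monoid_mult)"
  by (induction as) (auto simp: mult_ac)

lemma hyp_F_coeff:
  fixes a b \<mu> :: complex
  shows "fps_nth (fps_hypergeo (a # b # map (\<lambda>j. f j + of_nat (ms j)) [1..<Suc r]) (\<mu> # map f [1..<Suc r]) 1) n
     = pochhammer a n * pochhammer b n / (pochhammer \<mu> n * fact n)
       * ((\<Prod>j=1..r. pochhammer (f j + of_nat (ms j)) n) / (\<Prod>j=1..r. pochhammer (f j) n))"
proof -
  have pl: "prod_list (map g [1..<Suc r]) = (\<Prod>j=1..r. g j)" for g :: "nat \<Rightarrow> complex"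
    by (subst prod.distinct_set_conv_list[symmetric])
       (auto simp del: upt_Suc simp: atLeastLessThanSuc_atLeastAtMost)
  then show ?thesis
    unfolding fps_hypergeo_nth_alt foldr_mult_eq_prod_list list.map prod_list.Cons map_map o_def pl
    by (simp add: mult_ac)
qed

text \<open>
  The falling factorial \<open>fact k * (n choose k)\<close> cancels against \<open>fact n\<close> and leaves \<open>fact (n - k)\<close>, so the part of
  the series belonging to \<open>k\<close> starts at \<open>n = k\<close> and is, after an index shift, a \<open>\<^sub>2F\<^sub>1\<close> with all three
  parameters raised by \<open>k\<close>.
\<close>
theorem hyp_F_decomposition:
  assumes f: "\<forall>j\<in>{1..r}. f j \<notin> \<int>\<^sub>\<le>\<^sub>0" and m: "m = (\<Sum>j=1..r. ms j)"
    and mu: "\<mu> \<notin> \<int>\<^sub>\<le>\<^sub>0" and z: "norm z < 1"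
  shows "hyp_F a b \<mu> r f ms z = Gamma \<mu> * (\<Sum>k=0..m. coeff_A r f ms k / coeff_A r f ms 0
           * pochhammer a k * pochhammer b k * z ^ k
           * (\<Sum>n. gauss_term (a + of_nat k) (b + of_nat k) (\<mu> + of_nat k) n * z ^ n))"
proof -
  let ?\<alpha> = "\<lambda>k. coeff_A r f ms k / coeff_A r f ms 0"
  let ?G = "\<lambda>k. \<Sum>n. gauss_term (a + of_nat k) (b + of_nat k) (\<mu> + of_nat k) n * z ^ n"
  define g where "g k n = pochhammer a n * pochhammer b n / (pochhammer \<mu> n * fact n)
       * of_nat (fact k * (n choose k)) * z ^ n" for k n
  have g: "g k sums (Gamma \<mu> * (pochhammer a k * pochhammer b k * z ^ k * ?G k))" for k
  proof -
    have "summable (\<lambda>n. gauss_term (a + of_nat k) (b + of_nat k) (\<mu> + of_nat k) n * z ^ n)"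
      using gauss_series_summable[OF not_nonpos_Int_add_nat[OF mu] z] by (rule summable_norm_cancel)
    then have "(\<lambda>n. Gamma \<mu> * (pochhammer a k * pochhammer b k * z ^ k
          * (gauss_term (a + of_nat k) (b + of_nat k) (\<mu> + of_nat k) n * z ^ n)))
        sums (Gamma \<mu> * (pochhammer a k * pochhammer b k * z ^ k * ?G k))"
      by (intro sums_mult summable_sums)
    also have "(\<lambda>n. Gamma \<mu> * (pochhammer a k * pochhammer b k * z ^ k
          * (gauss_term (a + of_nat k) (b + of_nat k) (\<mu> + of_nat k) n * z ^ n))) = (\<lambda>n. g k (n + k))"
    proof
      fix n
      have a: "pochhammer a (n + k) = pochhammer a k * pochhammer (a + of_nat k) n"
        and b: "pochhammer b (n + k) = pochhammer b k * pochhammer (b + of_nat k) n"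
        by (simp_all add: add.commute[of n k] pochhammer_product')
      have nz: "pochhammer \<mu> (n + k) \<noteq> 0" "Gamma \<mu> \<noteq> 0"
        using mu pochhammer_eq_0_imp_nonpos_Int by (auto simp: Gamma_eq_zero_iff)
      have "rGamma \<mu> = pochhammer \<mu> (n + k) * rGamma (\<mu> + of_nat k + of_nat n)"
        using pochhammer_rGamma[of \<mu> "n + k"] by (simp add: add_ac)
      then have G: "Gamma \<mu> * rGamma (\<mu> + of_nat k + of_nat n) = 1 / pochhammer \<mu> (n + k)"
        using nz by (simp add: rGamma_inverse_Gamma field_simps)
      have "fact k * ((n + k) choose k) * fact n = fact (n + k)"
        using binomial_fact_lemma[of k "n + k"] by (simp add: mult_ac)
      then have "of_nat (fact k * ((n + k) choose k)) * fact n = (fact (n + k) :: complex)"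
        by (metis of_nat_fact of_nat_mult)
      then have c: "of_nat (fact k * ((n + k) choose k)) / fact (n + k) = (1 / fact n :: complex)"
        by (simp only: divide_eq_eq fact_nonzero eq_divide_eq mult_1 times_divide_eq_left) simp
      have "Gamma \<mu> * (pochhammer a k * pochhammer b k * z ^ k
          * (gauss_term (a + of_nat k) (b + of_nat k) (\<mu> + of_nat k) n * z ^ n))
        = pochhammer a (n + k) * pochhammer b (n + k) * (Gamma \<mu> * rGamma (\<mu> + of_nat k + of_nat n))
          * (1 / fact n) * z ^ (n + k)"
        unfolding gauss_term_def a b power_add by simp
      also have "\<dots> = g k (n + k)"
        unfolding G g_def c[symmetric] by simp
      finally show "Gamma \<mu> * (pochhammer a k * pochhammer b k * z ^ k
          * (gauss_term (a + of_nat k) (b + of_nat k) (\<mu> + of_nat k) n * z ^ n)) = g k (n + k)" .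
    qed
    finally show ?thesis
      by (subst (asm) sums_zero_iff_shift) (auto simp: g_def binomial_eq_0)
  qed
  have "(\<lambda>n. \<Sum>k=0..m. ?\<alpha> k * g k n) sums
      (\<Sum>k=0..m. ?\<alpha> k * (Gamma \<mu> * (pochhammer a k * pochhammer b k * z ^ k * ?G k)))"
    by (intro sums_sum sums_mult g)
  moreover have "(\<lambda>n. fps_nth (fps_hypergeo (a # b # map (\<lambda>j. f j + of_nat (ms j)) [1..<Suc r])
      (\<mu> # map f [1..<Suc r]) 1) n * z ^ n) = (\<lambda>n. \<Sum>k=0..m. ?\<alpha> k * g k n)"
    unfolding hyp_F_coeff prod_pochhammer_shift[OF f m] g_def sum_distrib_left sum_distrib_right
    by (simp only: divide_inverse inverse_mult_distrib mult_ac)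
  ultimately have "(\<lambda>n. fps_nth (fps_hypergeo (a # b # map (\<lambda>j. f j + of_nat (ms j)) [1..<Suc r])
      (\<mu> # map f [1..<Suc r]) 1) n * z ^ n) sums
      (\<Sum>k=0..m. ?\<alpha> k * (Gamma \<mu> * (pochhammer a k * pochhammer b k * z ^ k * ?G k)))"
    by (simp only:)
  then have "hyp_F a b \<mu> r f ms z
      = (\<Sum>k=0..m. ?\<alpha> k * (Gamma \<mu> * (pochhammer a k * pochhammer b k * z ^ k * ?G k)))"
    unfolding hyp_F_def eval_fps_def by (rule sums_unique[symmetric])
  then show ?thesis
    unfolding sum_distrib_left by (simp only: mult_ac)
qed

text \<open>
  The integrand of the operator of the first kind applied to a power, in the variable \<open>u = (t / x) powr \<nu>\<close>
  and without its dependence on \<open>x\<close>.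
\<close>
definition unit_kernel where
  "unit_kernel a b \<mu> r f ms c u = hyp_F a b \<mu> r f ms (of_real (1 - u)) / Gamma \<mu>
     * (of_real u powr (c - 1) * of_real (1 - u) powr (\<mu> - 1))"

text \<open>
  The power \<open>(1 - u) ^ k\<close> from the decomposition is absorbed by raising \<open>\<mu>\<close> to \<open>\<mu> + k\<close>. The exponent \<open>c\<close> is
  the same in all summands.
\<close>
lemma unit_kernel_eq:
  assumes f: "\<forall>j\<in>{1..r}. f j \<notin> \<int>\<^sub>\<le>\<^sub>0" and m: "m = (\<Sum>j=1..r. ms j)"
    and mu: "\<mu> \<notin> \<int>\<^sub>\<le>\<^sub>0" and u: "u \<in> {0<..<1}"
  shows "unit_kernel a b \<mu> r f ms c u = (\<Sum>k=0..m. coeff_A r f ms k / coeff_A r f ms 0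
           * pochhammer a k * pochhammer b k
           * euler_kernel (a + of_nat k) (b + of_nat k) (\<mu> + of_nat k) c u)"
proof -
  let ?G = "\<lambda>k. \<Sum>n. gauss_term (a + of_nat k) (b + of_nat k) (\<mu> + of_nat k) n * of_real (1 - u) ^ n"
  let ?p = "of_real u powr (c - 1)" and ?q = "of_real (1 - u) powr (\<mu> - 1)"
  have "Gamma \<mu> \<noteq> 0" using mu by (simp add: Gamma_eq_zero_iff)
  moreover have "norm (complex_of_real (1 - u)) < 1"
    using u unfolding norm_of_real by auto
  ultimately have "unit_kernel a b \<mu> r f ms c u = (\<Sum>k=0..m. coeff_A r f ms k / coeff_A r f ms 0
           * pochhammer a k * pochhammer b k * of_real (1 - u) ^ k * ?G k) * (?p * ?q)"
    unfolding unit_kernel_def by (subst hyp_F_decomposition[OF f m mu]) auto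
  also have "\<dots> = (\<Sum>k=0..m. coeff_A r f ms k / coeff_A r f ms 0
           * pochhammer a k * pochhammer b k
           * (?G k * (?p * (?q * of_real (1 - u) ^ k))))"
    unfolding sum_distrib_right by (simp only: mult_ac)
  also have "\<dots> = (\<Sum>k=0..m. coeff_A r f ms k / coeff_A r f ms 0
           * pochhammer a k * pochhammer b k
           * euler_kernel (a + of_nat k) (b + of_nat k) (\<mu> + of_nat k) c u)"
  proof (rule sum.cong[OF refl])
    fix k
    have "\<mu> + of_nat k - 1 = \<mu> - 1 + of_nat k" by simp
    then have "?q * of_real (1 - u) ^ k = complex_of_real (1 - u) powr (\<mu> + of_nat k - 1)"
      using u by (simp only: of_real_powr_add_nat greaterThanLessThan_iff diff_gt_0_iff_gt)
    then show "coeff_A r f ms k / coeff_A r f ms 0 * pochhammer a k * pochhammer b k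
           * (?G k * (?p * (?q * of_real (1 - u) ^ k)))
         = coeff_A r f ms k / coeff_A r f ms 0 * pochhammer a k * pochhammer b k
           * euler_kernel (a + of_nat k) (b + of_nat k) (\<mu> + of_nat k) c u"
      unfolding euler_kernel_def by simp
  qed
  finally show ?thesis .
qed

section \<open>The kernel on the unit interval\<close>

lemma power_substitution:
  fixes g :: "real \<Rightarrow> 'a :: euclidean_space"
  assumes x: "x > 0" and nu: "\<nu> > 0" and g: "set_integrable lebesgue {0<..<1} g"
  defines "G \<equiv> \<lambda>t. (\<nu> * t powr (\<nu> - 1) / x powr \<nu>) *\<^sub>R g (t powr \<nu> / x powr \<nu>)"
  shows "set_integrable lebesgue {0<..<x} G"
    and "(LINT t:{0<..<x}|lebesgue. G t) = (LINT u:{0<..<1}|lebesgue. g u)"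
proof -
  let ?w = "\<lambda>t. t powr \<nu> / x powr \<nu>"
  let ?w' = "\<lambda>t. \<nu> * t powr (\<nu> - 1) / x powr \<nu>"
  have img: "?w ` {0<..<x} = {0<..<1}"
  proof (intro equalityI subsetI)
    fix u assume "u \<in> ?w ` {0<..<x}"
    then show "u \<in> {0<..<1}" using x nu by (auto simp: powr_less_mono2)
  next
    fix u :: real assume u: "u \<in> {0<..<1}"
    then have "u powr (1 / \<nu>) < 1 powr (1 / \<nu>)"
      using nu by (intro powr_less_mono2) auto
    then have "x * u powr (1 / \<nu>) \<in> {0<..<x}" using u x by simp
    moreover have "?w (x * u powr (1 / \<nu>)) = u"
      using u x nu by (simp add: powr_mult powr_powr)
    ultimately show "u \<in> ?w ` {0<..<x}" by force
  qed
  have inj: "inj_on ?w {0<..<x}"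
  proof (rule inj_onI)
    fix t t' assume t: "t \<in> {0<..<x}" "t' \<in> {0<..<x}" and "?w t = ?w t'"
    then have "t powr \<nu> = t' powr \<nu>" using x by simp
    then have "(t powr \<nu>) powr (1 / \<nu>) = (t' powr \<nu>) powr (1 / \<nu>)" by simp
    then show "t = t'" using t nu by (simp add: powr_powr)
  qed
  have der: "(?w has_field_derivative ?w' t) (at t within {0<..<x})" if "t \<in> {0<..<x}" for t
    using that x nu by (auto intro!: derivative_eq_intros simp: field_simps powr_diff)
  have eq: "G t = \<bar>?w' t\<bar> *\<^sub>R g (?w t)" if "t \<in> {0<..<x}" for t
    using that nu by (simp add: G_def)
  have "g absolutely_integrable_on ?w ` {0<..<x}
      \<and> integral (?w ` {0<..<x}) g = integral {0<..<1} g"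
    using g unfolding img by simp
  then have *: "(\<lambda>t. \<bar>?w' t\<bar> *\<^sub>R g (?w t)) absolutely_integrable_on {0<..<x}
      \<and> integral {0<..<x} (\<lambda>t. \<bar>?w' t\<bar> *\<^sub>R g (?w t)) = integral {0<..<1} g"
    by (subst has_absolute_integral_change_of_variables_real[OF _ der inj]) auto
  have cong: "set_integrable lebesgue {0<..<x} G
      \<longleftrightarrow> set_integrable lebesgue {0<..<x} (\<lambda>t. \<bar>?w' t\<bar> *\<^sub>R g (?w t))"
    by (intro set_integrable_cong refl eq)
  show "set_integrable lebesgue {0<..<x} G"
    unfolding cong using * by (rule conjunct1)
  have "(LINT t:{0<..<x}|lebesgue. G t) = (LINT t:{0<..<x}|lebesgue. \<bar>?w' t\<bar> *\<^sub>R g (?w t))"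
    using eq by (intro set_lebesgue_integral_cong) auto
  also have "\<dots> = (LINT u:{0<..<1}|lebesgue. g u)"
    unfolding set_lebesgue_integral_eq_integral(2)[OF g] set_lebesgue_integral_eq_integral(2)[OF conjunct1[OF *]]
    by (rule conjunct2[OF *])
  finally show "(LINT t:{0<..<x}|lebesgue. G t) = (LINT u:{0<..<1}|lebesgue. g u)"
    .
qed

text \<open>
  The standing assumptions on the parameters. The last one makes \<open>C = c1 h \<nu> lam\<close> and all the
  \<open>C + pk \<mu> a b k\<close> with \<open>k \<le> m\<close> have positive real part, as the integrals of the Euler kernels require.
\<close>
locale frac_laplace =
  fixes h \<nu> :: real and r :: nat
    and \<mu> \<delta> lam a b :: complex and f :: "nat \<Rightarrow> complex" and ms :: "nat \<Rightarrow> nat" and m :: nat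
  assumes nu: "\<nu> > 0"
    and mu: "Re \<mu> > 0"
    and f: "\<forall>j\<in>{1..r}. f j \<notin> \<int>\<^sub>\<le>\<^sub>0"
    and m: "m = (\<Sum>j=1..r. ms j)"
    and c1: "Re (c1 h \<nu> lam) > - min 0 (Re (pk \<mu> a b m))"
begin

abbreviation C :: complex where "C \<equiv> c1 h \<nu> lam"

abbreviation weight :: "nat \<Rightarrow> complex" where
  "weight k \<equiv> coeff_A r f ms k / coeff_A r f ms 0 * pochhammer a k * pochhammer b k"

abbreviation U :: "real \<Rightarrow> complex" where "U \<equiv> unit_kernel a b \<mu> r f ms C"

lemma C_pos: "Re C > 0"
  using c1 by (simp add: min_def split: if_splits)

lemma C_pk_pos: "k \<le> m \<Longrightarrow> Re (C + pk \<mu> a b k) > 0"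
  using c1 by (simp add: pk_def min_def split: if_splits)

lemma Gamma_mu_nonzero: "Gamma \<mu> \<noteq> 0"
  using Re_pos_not_nonpos_Int[OF mu] by (simp add: Gamma_eq_zero_iff)

lemma unit_kernel_exp_integral:
  shows "set_integrable lebesgue {0<..<1} (\<lambda>u. U u * exp (z * of_real (u powr (1 / \<nu>))))"
    and "(LINT u:{0<..<1}|lebesgue. U u * exp (z * of_real (u powr (1 / \<nu>))))
           = (\<Sum>k=0..m. weight k * fox_wright [(C, 1 / \<nu>), (C + pk \<mu> a b k, 1 / \<nu>)]
                                 [(C + \<mu> - a, 1 / \<nu>), (C + \<mu> - b, 1 / \<nu>)] z)"
proof -
  define E where "E k u = indicator {0<..<1} u *\<^sub>R
      (euler_kernel (a + of_nat k) (b + of_nat k) (\<mu> + of_nat k) C u * exp (z * of_real (u powr (1 / \<nu>))))"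
    for k and u :: real
  have args: "C + (\<mu> + of_nat k) - (a + of_nat k) - (b + of_nat k) = C + pk \<mu> a b k"
    "C + (\<mu> + of_nat k) - (a + of_nat k) = C + \<mu> - a"
    "C + (\<mu> + of_nat k) - (b + of_nat k) = C + \<mu> - b" for k
    by (simp_all add: pk_def algebra_simps)
  have mk: "Re (\<mu> + of_nat k) > 0" for k using mu by simp
  have conv: "Re (C + (\<mu> + of_nat k) - (a + of_nat k) - (b + of_nat k)) > 0" if "k \<le> m" for k
    unfolding args(1) by (rule C_pk_pos[OF that])
  have E_int: "integrable lebesgue (E k)" if "k \<le> m" for k
    using euler_kernel_exp_integral(1)[OF mk C_pos conv[OF that] nu, of z]
    unfolding E_def set_integrable_def .
  have E_val: "integral\<^sup>L lebesgue (E k) = fox_wright [(C, 1 / \<nu>), (C + pk \<mu> a b k, 1 / \<nu>)]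
                                 [(C + \<mu> - a, 1 / \<nu>), (C + \<mu> - b, 1 / \<nu>)] z" if "k \<le> m" for k
    using euler_kernel_exp_integral(2)[OF mk C_pos conv[OF that] nu, of z]
    unfolding E_def set_lebesgue_integral_def args(1) unfolding args(2,3) .
  have eq: "indicator {0<..<1} u *\<^sub>R (U u * exp (z * of_real (u powr (1 / \<nu>)))) = (\<Sum>k=0..m. weight k * E k u)"
    for u :: real
  proof (cases "u \<in> {0<..<1}")
    case True
    then show ?thesis
      unfolding unit_kernel_eq[OF f m Re_pos_not_nonpos_Int[OF mu] True]
      by (simp add: E_def sum_distrib_right mult.assoc)
  qed (simp add: E_def)
  show "set_integrable lebesgue {0<..<1} (\<lambda>u. U u * exp (z * of_real (u powr (1 / \<nu>))))"
    unfolding set_integrable_def eq using E_int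
    by (intro Bochner_Integration.integrable_sum integrable_mult_right) auto
  have "(LINT u:{0<..<1}|lebesgue. U u * exp (z * of_real (u powr (1 / \<nu>))))
      = (\<Sum>k=0..m. weight k * integral\<^sup>L lebesgue (E k))"
    unfolding set_lebesgue_integral_def eq using E_int
    by (subst Bochner_Integration.integral_sum) (auto intro!: sum.cong)
  also have "\<dots> = (\<Sum>k=0..m. weight k * fox_wright [(C, 1 / \<nu>), (C + pk \<mu> a b k, 1 / \<nu>)]
                                 [(C + \<mu> - a, 1 / \<nu>), (C + \<mu> - b, 1 / \<nu>)] z)"
    by (intro sum.cong refl arg_cong[where f = "(*) _"] E_val) (simp only: atLeastAtMost_iff)
  finally show "(LINT u:{0<..<1}|lebesgue. U u * exp (z * of_real (u powr (1 / \<nu>))))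
           = (\<Sum>k=0..m. weight k * fox_wright [(C, 1 / \<nu>), (C + pk \<mu> a b k, 1 / \<nu>)]
                                 [(C + \<mu> - a, 1 / \<nu>), (C + \<mu> - b, 1 / \<nu>)] z)"
    .
qed

lemma unit_kernel_integrable: "set_integrable lebesgue {0<..<1} U"
  using unit_kernel_exp_integral(1)[of 0] by simp

definition prefactor :: "real \<Rightarrow> complex" where
  "prefactor x = of_real \<nu> * of_real x powr (- \<delta> - of_real \<nu> * (\<mu> + of_real h)) / Gamma \<mu>"

lemma prefactor_nonzero: "x > 0 \<Longrightarrow> prefactor x \<noteq> 0"
  using nu Gamma_mu_nonzero by (simp add: prefactor_def powr_def)

lemma of_real_powr_exp:
  assumes "y > 0"
  shows "complex_of_real y powr z = exp (z * of_real (ln y))"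
    and "complex_of_real (y powr p) = exp (of_real p * of_real (ln y))"
  using assms by (auto simp: powr_def Ln_of_real exp_of_real simp flip: of_real_mult)

text \<open>
  Homogeneity of the integrand: with \<open>u = (t / x) powr \<nu>\<close> all powers of \<open>x\<close> collect into
  \<open>x powr (lam - \<delta>)\<close> and the Jacobian of the substitution. The powers are compared through their
  logarithms \<open>X\<close>, \<open>T\<close> and \<open>L\<close> of \<open>x\<close>, \<open>t\<close> and \<open>1 - u\<close>, where the claim is an identity of linear forms.
\<close>
lemma I_integrand_rescale:
  assumes t: "t \<in> {0<..<x}"
  shows "prefactor x * I_integrand h \<nu> \<mu> a b r f ms (power_exp lam s) x t
     = of_real x powr (lam - \<delta>) * ((\<nu> * t powr (\<nu> - 1) / x powr \<nu>) *\<^sub>R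
         (U (t powr \<nu> / x powr \<nu>) * exp (- s * of_real x * of_real ((t powr \<nu> / x powr \<nu>) powr (1 / \<nu>)))))"
proof -
  define u where "u = t powr \<nu> / x powr \<nu>"
  have x0: "x > 0" and t0: "t > 0" using t by auto
  have u: "u \<in> {0<..<1}" using t nu unfolding u_def by (simp add: powr_less_mono2)
  define X where "X = complex_of_real (ln x)"
  define T where "T = complex_of_real (ln t)"
  define L where "L = complex_of_real (ln (1 - u))"
  have root: "u powr (1 / \<nu>) = t / x"
    using t nu unfolding u_def by (simp add: powr_divide powr_powr)
  have lnu: "complex_of_real (ln u) = of_real \<nu> * (T - X)"
    using t nu unfolding u_def by (simp add: ln_div ln_powr T_def X_def algebra_simps)
  have diff: "x powr \<nu> - t powr \<nu> = x powr \<nu> * (1 - u)"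
    using x0 unfolding u_def by (simp add: field_simps)
  have lndiff: "complex_of_real (ln (x powr \<nu> * (1 - u))) = of_real \<nu> * X + L"
    using x0 u by (simp add: ln_mult ln_powr X_def L_def)
  have dpos: "x powr \<nu> * (1 - u) > 0" using x0 u by simp
  have Cm: "of_real \<nu> * (C - 1) = of_real \<nu> * of_real h + lam"
    using nu by (simp add: c1_def field_simps)
  define HF where "HF = hyp_F a b \<mu> r f ms (of_real (1 - u))"
  have "prefactor x * I_integrand h \<nu> \<mu> a b r f ms (power_exp lam s) x t
      = of_real \<nu> / Gamma \<mu> * HF * exp (- s * of_real t) *
        (exp ((- \<delta> - of_real \<nu> * (\<mu> + of_real h)) * X) * exp ((\<mu> - 1) * (of_real \<nu> * X + L))
         * exp (lam * T) * exp (of_real (\<nu> * h + \<nu> - 1) * T))"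
    unfolding prefactor_def I_integrand_def power_exp_def u_def[symmetric] HF_def[symmetric] diff
      of_real_powr_exp[OF dpos] of_real_powr_exp[OF x0] of_real_powr_exp[OF t0] lndiff
      X_def[symmetric] T_def[symmetric]
    by simp
  also have "exp ((- \<delta> - of_real \<nu> * (\<mu> + of_real h)) * X) * exp ((\<mu> - 1) * (of_real \<nu> * X + L))
         * exp (lam * T) * exp (of_real (\<nu> * h + \<nu> - 1) * T)
      = exp ((- \<delta> - of_real \<nu> * (\<mu> + of_real h)) * X + (\<mu> - 1) * (of_real \<nu> * X + L)
         + lam * T + of_real (\<nu> * h + \<nu> - 1) * T)"
    by (simp only: exp_add)
  also have "(- \<delta> - of_real \<nu> * (\<mu> + of_real h)) * X + (\<mu> - 1) * (of_real \<nu> * X + L)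
         + lam * T + of_real (\<nu> * h + \<nu> - 1) * T
     = (lam - \<delta>) * X + of_real (\<nu> - 1) * T + (- of_real \<nu> * X)
         + (of_real \<nu> * of_real h + lam) * (T - X) + (\<mu> - 1) * L"
    by (simp add: algebra_simps)
  also have "\<dots> = (lam - \<delta>) * X + of_real (\<nu> - 1) * T + (- of_real \<nu> * X)
         + (C - 1) * (of_real \<nu> * (T - X)) + (\<mu> - 1) * L"
    unfolding Cm[symmetric] by (simp only: mult_ac)
  also have "exp \<dots> = exp ((lam - \<delta>) * X) * exp (of_real (\<nu> - 1) * T) * inverse (exp (of_real \<nu> * X))
         * exp ((C - 1) * (of_real \<nu> * (T - X))) * exp ((\<mu> - 1) * L)"
    by (simp only: exp_add mult_minus_left exp_minus)
  also have "\<dots> = of_real x powr (lam - \<delta>) * of_real (t powr (\<nu> - 1)) * inverse (of_real (x powr \<nu>))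
         * of_real u powr (C - 1) * of_real (1 - u) powr (\<mu> - 1)"
    using u of_real_powr_exp(1)[of u] of_real_powr_exp(1)[of "1 - u"]
    unfolding of_real_powr_exp[OF x0] of_real_powr_exp[OF t0] X_def[symmetric] T_def[symmetric]
      lnu[symmetric] L_def by (simp only: greaterThanLessThan_iff diff_gt_0_iff_gt)
  finally show ?thesis
    using x0 unfolding u_def[symmetric] root unit_kernel_def HF_def[symmetric]
    by (simp add: scaleR_conv_of_real divide_inverse mult_ac)
qed

text \<open>
  The norm estimate is what Fubini's theorem needs: since \<open>exp\<close> has norm at most \<open>1\<close> for \<open>Re s > 0\<close>, the
  integral over \<open>0 < t < x\<close> is at most \<open>norm (x powr (lam - \<delta>))\<close> times a constant independent of \<open>x\<close>.
\<close>
lemma kernel_integrand: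
  assumes x: "x > 0"
  shows "set_integrable lebesgue {0<..<x} (I_integrand h \<nu> \<mu> a b r f ms (power_exp lam s) x)"
    and "kernel_J h \<nu> \<mu> \<delta> lam a b r f ms s x = of_real x powr (lam - \<delta>)
          * (LINT u:{0<..<1}|lebesgue. U u * exp (- s * of_real x * of_real (u powr (1 / \<nu>))))"
    and "Re s > 0 \<Longrightarrow>
      (LINT t:{0<..<x}|lebesgue. norm (prefactor x * I_integrand h \<nu> \<mu> a b r f ms (power_exp lam s) x t))
        \<le> norm (of_real x powr (lam - \<delta>)) * (LINT u:{0<..<1}|lebesgue. norm (U u))"
proof -
  let ?I = "I_integrand h \<nu> \<mu> a b r f ms (power_exp lam s) x"
  let ?g = "\<lambda>u. U u * exp (- s * of_real x * of_real (u powr (1 / \<nu>)))"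
  let ?d = "\<lambda>t. \<nu> * t powr (\<nu> - 1) / x powr \<nu>"
  have g: "set_integrable lebesgue {0<..<1} ?g" by (rule unit_kernel_exp_integral(1))
  note sub = power_substitution[OF x nu g]
  have eq: "?I t = of_real x powr (lam - \<delta>) / prefactor x * (?d t *\<^sub>R ?g (t powr \<nu> / x powr \<nu>))"
    if "t \<in> {0<..<x}" for t
  proof -
    have "?I t = prefactor x * ?I t / prefactor x" using prefactor_nonzero[OF x] by simp
    then show ?thesis
      unfolding I_integrand_rescale[OF that] by (simp only: times_divide_eq_left)
  qed
  have "set_integrable lebesgue {0<..<x} ?I \<longleftrightarrow> set_integrable lebesgue {0<..<x}
      (\<lambda>t. of_real x powr (lam - \<delta>) / prefactor x * (?d t *\<^sub>R ?g (t powr \<nu> / x powr \<nu>)))"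
    by (rule set_integrable_cong[OF refl refl eq])
  then show "set_integrable lebesgue {0<..<x} ?I"
    using set_integrable_mult_right[OF sub(1)] by blast
  have "(LINT t:{0<..<x}|lebesgue. ?I t) = (LINT t:{0<..<x}|lebesgue.
      of_real x powr (lam - \<delta>) / prefactor x * (?d t *\<^sub>R ?g (t powr \<nu> / x powr \<nu>)))"
    using eq by (intro set_lebesgue_integral_cong) auto
  also have "\<dots> = of_real x powr (lam - \<delta>) / prefactor x * (LINT u:{0<..<1}|lebesgue. ?g u)"
    unfolding set_integral_mult_right sub(2) ..
  finally have "prefactor x * (LINT t:{0<..<x}|lebesgue. ?I t)
      = of_real x powr (lam - \<delta>) * (LINT u:{0<..<1}|lebesgue. ?g u)"
    using prefactor_nonzero[OF x] by simp
  then show "kernel_J h \<nu> \<mu> \<delta> lam a b r f ms s x = of_real x powr (lam - \<delta>)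
          * (LINT u:{0<..<1}|lebesgue. ?g u)"
    unfolding kernel_J_def frac_I_def prefactor_def .
  assume s: "Re s > 0"
  have gn: "set_integrable lebesgue {0<..<1} (\<lambda>u. norm (?g u))"
    using g by (rule set_integrable_norm)
  have "(LINT t:{0<..<x}|lebesgue. norm (prefactor x * ?I t))
      = (LINT t:{0<..<x}|lebesgue. norm (of_real x powr (lam - \<delta>)) * (?d t *\<^sub>R norm (?g (t powr \<nu> / x powr \<nu>))))"
    using I_integrand_rescale[where s = s] nu x
    by (intro set_lebesgue_integral_cong) (auto simp: norm_mult)
  also have "\<dots> = norm (of_real x powr (lam - \<delta>)) * (LINT u:{0<..<1}|lebesgue. norm (?g u))"
    unfolding set_integral_mult_right power_substitution(2)[OF x nu gn] ..
  also have "(LINT u:{0<..<1}|lebesgue. norm (?g u)) \<le> (LINT u:{0<..<1}|lebesgue. norm (U u))"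
  proof (rule set_integral_mono[OF gn])
    show "set_integrable lebesgue {0<..<1} (\<lambda>u. norm (U u))"
      using unit_kernel_integrable by (rule set_integrable_norm)
    fix u :: real
    have "norm (exp (- s * of_real x * of_real (u powr (1 / \<nu>)))) \<le> 1"
      using s x by simp
    then show "norm (?g u) \<le> norm (U u)"
      unfolding norm_mult by (intro mult_left_le) auto
  qed
  finally show "(LINT t:{0<..<x}|lebesgue. norm (prefactor x * ?I t))
        \<le> norm (of_real x powr (lam - \<delta>)) * (LINT u:{0<..<1}|lebesgue. norm (U u))"
    by (simp add: mult_left_mono)
qed

end

section \<open>Exchange of the order of integration\<close>

lemma sigma_finite_lebesgue: "sigma_finite_measure (lebesgue :: real measure)"
proof
  obtain A :: "real set set" where A: "countable A" "A \<subseteq> sets lborel" "\<Union>A = space lborel"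
      "\<forall>a\<in>A. emeasure lborel a \<noteq> \<infinity>"
    using sigma_finite_measure.sigma_finite_countable[OF sigma_finite_lborel[where 'a = real]] by metis
  have "A \<subseteq> sets lebesgue"
    using A(2) sets_completionI_sets by blast
  moreover have "emeasure lebesgue a \<noteq> \<infinity>" if "a \<in> A" for a
  proof -
    have a: "a \<in> sets lborel" using A(2) that by blast
    then have "emeasure lebesgue a = emeasure lborel a"
      by (simp only: emeasure_completion sets_completionI_sets main_part)
    then show ?thesis using A(4) that by simp
  qed
  moreover have "\<Union>A = space lebesgue" using A(3) by simp
  ultimately show "\<exists>A::real set set. countable A \<and> A \<subseteq> sets lebesgue \<and> \<Union>A = space lebesgue
      \<and> (\<forall>a\<in>A. emeasure lebesgue a \<noteq> \<infinity>)"
    using A(1) by (intro exI[of _ A] conjI ballI) auto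
qed

lemma borel_measurable_hyp_F [measurable]: "hyp_F a b \<mu> r f ms \<in> borel_measurable borel"
  unfolding hyp_F_def eval_fps_def by measurable

context frac_laplace
begin

definition laplace_kernel :: "complex \<Rightarrow> real \<Rightarrow> real \<Rightarrow> complex" where
  "laplace_kernel s t x = prefactor t * I_integrand h \<nu> \<mu> a b r f ms (power_exp lam s) t x"

lemma borel_measurable_laplace_kernel:
  "(\<lambda>p. laplace_kernel s (fst p) (snd p)) \<in> borel_measurable (borel \<Otimes>\<^sub>M borel)"
  unfolding laplace_kernel_def prefactor_def I_integrand_def power_exp_def by measurable

text \<open>
  The same kernel read from the side of the operator of the second kind: both integrands contain the same
  power of \<open>t powr \<nu> - x powr \<nu>\<close> and the same hypergeometric function.
\<close>
lemma laplace_kernel_J: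
  assumes "x > 0" "x < t"
  shows "laplace_kernel s t x * y = exp (- s * of_real x) * (of_real x powr lam
           * (of_real \<nu> * of_real (x powr (\<nu> * h + \<nu> - 1)) / Gamma \<mu>))
         * (of_real (t powr \<nu> - x powr \<nu>) powr (\<mu> - 1)
       * hyp_F a b \<mu> r f ms (of_real (1 - x powr \<nu> / t powr \<nu>))
       * y * of_real t powr (- \<delta> - of_real \<nu> * (\<mu> + of_real h)))"
  unfolding laplace_kernel_def prefactor_def I_integrand_def power_exp_def
  by (simp only: divide_inverse mult_ac)

context
  fixes \<phi> :: "real \<Rightarrow> complex" and s :: complex
  assumes phi: "set_integrable lebesgue {0<..} (\<lambda>x. of_real x powr (lam - \<delta>) * \<phi> x)"
    and s: "Re s > 0"
begin

text \<open>
  Only the product of \<open>\<phi>\<close> with the power of its argument is known to be measurable, and only on the positive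
  half-line. The integrand on the plane is therefore built from this product, with the power divided out
  again by an explicit Borel factor.
\<close>
definition \<psi> :: "real \<Rightarrow> complex" where
  "\<psi> t = indicator {0<..} t *\<^sub>R (of_real t powr (lam - \<delta>) * \<phi> t)"

definition joint :: "real \<Rightarrow> real \<Rightarrow> complex" where
  "joint t x = (if 0 < x \<and> x < t then of_real t powr (\<delta> - lam) * laplace_kernel s t x * \<psi> t else 0)"

lemma psi_integrable: "integrable lebesgue \<psi>"
  using phi unfolding set_integrable_def \<psi>_def .

lemma joint_eq:
  "joint t x = (if 0 < x \<and> x < t then laplace_kernel s t x * \<phi> t else 0)"
proof (cases "0 < x \<and> x < t")
  case True
  then have "of_real t powr (\<delta> - lam) * of_real t powr (lam - \<delta>) = (1 :: complex)"
    by (simp flip: powr_add)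
  moreover have "joint t x
      = (of_real t powr (\<delta> - lam) * of_real t powr (lam - \<delta>)) * (laplace_kernel s t x * \<phi> t)"
    using True by (simp add: joint_def \<psi>_def)
  ultimately show ?thesis using True by simp
qed (auto simp: joint_def)

text \<open>
  The kernel is a Borel function on the plane, but \<open>\<psi>\<close> is only Lebesgue measurable; hence the product of the
  completed measures.
\<close>
lemma joint_measurable: "(\<lambda>(t, x). joint t x) \<in> borel_measurable (lebesgue \<Otimes>\<^sub>M lebesgue)"
proof -
  have id: "(\<lambda>x::real. x) \<in> borel_measurable lebesgue"
    by (rule measurable_completion) simp
  let ?L = "(lebesgue :: real measure) \<Otimes>\<^sub>M (lebesgue :: real measure)"
  have fst: "fst \<in> borel_measurable ?L"
    by (rule measurable_compose[OF measurable_fst id])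
  have snd: "snd \<in> borel_measurable ?L"
    by (rule measurable_compose[OF measurable_snd id])
  have ker: "(\<lambda>p. laplace_kernel s (fst p) (snd p)) \<in> borel_measurable ?L"
    using measurable_compose[OF measurable_Pair[OF fst snd] borel_measurable_laplace_kernel[of s]] by simp
  have "\<psi> \<in> borel_measurable lebesgue"
    using psi_integrable by (rule borel_measurable_integrable)
  from measurable_compose[OF measurable_fst this]
  have psi: "(\<lambda>p. \<psi> (fst p)) \<in> borel_measurable ?L" .
  note [measurable] = fst snd ker psi
  show ?thesis
    unfolding joint_def case_prod_beta by measurable
qed

lemma joint_fst:
  "joint t = (\<lambda>x. \<phi> t * (indicator {0<..<t} x *\<^sub>R laplace_kernel s t x))"
  by (auto simp: joint_eq fun_eq_iff)

lemma laplace_kernel_integrable: "t > 0 \<Longrightarrow> set_integrable lebesgue {0<..<t} (laplace_kernel s t)"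
  unfolding laplace_kernel_def
  by (intro set_integrable_mult_right kernel_integrand(1))

lemma joint_integrable_fst: "integrable lebesgue (joint t)"
proof (cases "t > 0")
  case True
  then show ?thesis
    using laplace_kernel_integrable[OF True] unfolding set_integrable_def joint_fst
    by (intro integrable_mult_right)
qed (simp add: joint_fst)

lemma joint_integral_fst:
  "(\<integral>x. joint t x \<partial>lebesgue) = indicator {0<..} t *\<^sub>R (kernel_J h \<nu> \<mu> \<delta> lam a b r f ms s t * \<phi> t)"
proof (cases "t > 0")
  case True
  have "(\<integral>x. joint t x \<partial>lebesgue) = \<phi> t * (LINT x:{0<..<t}|lebesgue. laplace_kernel s t x)"
    unfolding joint_fst set_lebesgue_integral_def by (rule integral_mult_right_zero)
  also have "(LINT x:{0<..<t}|lebesgue. laplace_kernel s t x) = kernel_J h \<nu> \<mu> \<delta> lam a b r f ms s t"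
    unfolding laplace_kernel_def kernel_J_def frac_I_def prefactor_def by simp
  finally show ?thesis using True by simp
qed (simp add: joint_fst)

lemma joint_norm_bound:
  "(\<integral>x. norm (joint t x) \<partial>lebesgue) \<le> (LINT u:{0<..<1}|lebesgue. norm (U u)) * norm (\<psi> t)"
proof (cases "t > 0")
  case True
  have "(\<integral>x. norm (joint t x) \<partial>lebesgue) = norm (\<phi> t) * (LINT x:{0<..<t}|lebesgue. norm (laplace_kernel s t x))"
  proof -
    have "norm (joint t x) = norm (\<phi> t) * (indicator {0<..<t} x *\<^sub>R norm (laplace_kernel s t x))" for x
      by (simp add: joint_fst norm_mult indicator_def)
    then show ?thesis
      unfolding set_lebesgue_integral_def by (simp only: integral_mult_right_zero)
  qed
  also have "\<dots> \<le> norm (\<phi> t) * (norm (of_real t powr (lam - \<delta>)) * (LINT u:{0<..<1}|lebesgue. norm (U u)))"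
    unfolding laplace_kernel_def using kernel_integrand(3)[OF True s] by (intro mult_left_mono) auto
  finally show ?thesis using True by (simp add: \<psi>_def norm_mult mult_ac)
next
  case False
  have "0 \<le> (LINT u:{0<..<1}|lebesgue. norm (U u))"
    unfolding set_lebesgue_integral_def by (intro integral_nonneg_AE) auto
  with False show ?thesis by (simp add: joint_fst)
qed

text \<open>
  The inner integrals of the norms are dominated by a multiple of \<open>norm (\<psi> t)\<close>, so the integrability of \<open>\<psi>\<close> is
  exactly what is needed.
\<close>
lemma joint_integrable: "integrable (lebesgue \<Otimes>\<^sub>M lebesgue) (\<lambda>(t, x). joint t x)"
proof -
  interpret L: sigma_finite_measure "lebesgue :: real measure" by (rule sigma_finite_lebesgue)
  interpret pair_sigma_finite "lebesgue :: real measure" "lebesgue :: real measure" ..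
  show ?thesis
  proof (rule Fubini_integrable[OF joint_measurable])
    have "integrable lebesgue (\<lambda>t. (LINT u:{0<..<1}|lebesgue. norm (U u)) * norm (\<psi> t))"
      using psi_integrable by (intro integrable_mult_right integrable_norm)
    moreover have "(\<lambda>t. \<integral>x. norm (joint t x) \<partial>lebesgue) \<in> borel_measurable lebesgue"
      using joint_measurable by (intro L.borel_measurable_lebesgue_integral) (simp add: case_prod_beta)
    ultimately have "integrable lebesgue (\<lambda>t. \<integral>x. norm (joint t x) \<partial>lebesgue)"
    proof (rule Bochner_Integration.integrable_bound)
      show "AE t in lebesgue. norm (\<integral>x. norm (joint t x) \<partial>lebesgue)
          \<le> norm ((LINT u:{0<..<1}|lebesgue. norm (U u)) * norm (\<psi> t))"
        using joint_norm_bound by (intro AE_I2) (auto simp: integral_nonneg_AE intro: order.trans[OF _ abs_ge_self])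
    qed
    then show "integrable lebesgue (\<lambda>t. \<integral>x. norm (case (t, x) of (t, x) \<Rightarrow> joint t x) \<partial>lebesgue)"
      by simp
    show "AE t in lebesgue. integrable lebesgue (\<lambda>x. case (t, x) of (t, x) \<Rightarrow> joint t x)"
      using joint_integrable_fst by simp
  qed
qed

text \<open>
  The part of \<open>joint t x\<close> that depends on \<open>x\<close> alone, so that it can be pulled out of the integral over \<open>t\<close>.
\<close>
definition J_factor :: "real \<Rightarrow> complex" where
  "J_factor x = exp (- s * of_real x) * (of_real x powr lam
           * (of_real \<nu> * of_real (x powr (\<nu> * h + \<nu> - 1)) / Gamma \<mu>))"

lemma joint_snd:
  assumes "x > 0"
  shows "(\<lambda>t. joint t x) = (\<lambda>t. J_factor x * (indicator {x<..} t *\<^sub>R J_integrand h \<nu> \<mu> \<delta> a b r f ms \<phi> x t))"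
proof
  fix t
  show "joint t x = J_factor x * (indicator {x<..} t *\<^sub>R J_integrand h \<nu> \<mu> \<delta> a b r f ms \<phi> x t)"
    using assms laplace_kernel_J[of x t s "\<phi> t"]
    by (cases "t > x") (auto simp: joint_eq J_factor_def J_integrand_def)
qed

lemma J_factor_nonzero: "x > 0 \<Longrightarrow> J_factor x \<noteq> 0"
  using nu Gamma_mu_nonzero by (simp add: J_factor_def powr_def)

text \<open>
  Fubini's theorem makes almost every section in \<open>t\<close> integrable, and the nonzero factor \<open>J_factor x\<close>, which
  carries the whole dependence on \<open>s\<close>, can be cancelled.
\<close>
lemma J_integrand_integrable_AE:
  "AE x in lebesgue. x > 0 \<longrightarrow> J_integrand h \<nu> \<mu> \<delta> a b r f ms \<phi> x absolutely_integrable_on {x<..}"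
proof -
  interpret L: sigma_finite_measure "lebesgue :: real measure" by (rule sigma_finite_lebesgue)
  interpret pair_sigma_finite "lebesgue :: real measure" "lebesgue :: real measure" ..
  have "AE x in lebesgue. integrable lebesgue (\<lambda>t. joint t x)"
    by (rule AE_integrable_snd[OF joint_integrable])
  then show ?thesis
  proof eventually_elim
    case (elim x)
    show ?case
    proof
      assume x: "x > 0"
      have "integrable lebesgue (\<lambda>t. J_factor x * (indicator {x<..} t *\<^sub>R J_integrand h \<nu> \<mu> \<delta> a b r f ms \<phi> x t))"
        using elim unfolding joint_snd[OF x] .
      then have "integrable lebesgue (\<lambda>t. inverse (J_factor x)
          * (J_factor x * (indicator {x<..} t *\<^sub>R J_integrand h \<nu> \<mu> \<delta> a b r f ms \<phi> x t)))"
        by (rule integrable_mult_right)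
      then show "J_integrand h \<nu> \<mu> \<delta> a b r f ms \<phi> x absolutely_integrable_on {x<..}"
        unfolding set_integrable_def
        by (simp only: mult.assoc[symmetric] left_inverse[OF J_factor_nonzero[OF x]] mult_1_left)
    qed
  qed
qed

lemma joint_integral_snd:
  "(\<integral>t. joint t x \<partial>lebesgue) = indicator {0<..} x *\<^sub>R
     (exp (- s * of_real x) * (of_real x powr lam * frac_J h \<nu> \<mu> \<delta> a b r f ms \<phi> x))"
proof (cases "x > 0")
  case True
  show ?thesis
    unfolding joint_snd[OF True] integral_mult_right_zero J_factor_def frac_J_def set_lebesgue_integral_def using True
    by (simp add: mult_ac)
qed (simp add: joint_eq)

theorem laplace_frac_J:
  shows "(\<lambda>x. exp (- s * of_real x) * (of_real x powr lam * frac_J h \<nu> \<mu> \<delta> a b r f ms \<phi> x))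
            absolutely_integrable_on {0<..}"
    and "(\<lambda>x. kernel_J h \<nu> \<mu> \<delta> lam a b r f ms s x * \<phi> x) absolutely_integrable_on {0<..}"
    and "laplace (\<lambda>x. of_real x powr lam * frac_J h \<nu> \<mu> \<delta> a b r f ms \<phi> x) s
          = (LINT x:{0<..}|lebesgue. kernel_J h \<nu> \<mu> \<delta> lam a b r f ms s x * \<phi> x)"
proof -
  interpret L: sigma_finite_measure "lebesgue :: real measure" by (rule sigma_finite_lebesgue)
  interpret pair_sigma_finite "lebesgue :: real measure" "lebesgue :: real measure" ..
  show "(\<lambda>x. exp (- s * of_real x) * (of_real x powr lam * frac_J h \<nu> \<mu> \<delta> a b r f ms \<phi> x))
            absolutely_integrable_on {0<..}"
    using integrable_snd[OF joint_integrable] unfolding joint_integral_snd set_integrable_def .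
  show "(\<lambda>x. kernel_J h \<nu> \<mu> \<delta> lam a b r f ms s x * \<phi> x) absolutely_integrable_on {0<..}"
    using integrable_fst[OF joint_integrable] unfolding joint_integral_fst set_integrable_def .
  show "laplace (\<lambda>x. of_real x powr lam * frac_J h \<nu> \<mu> \<delta> a b r f ms \<phi> x) s
          = (LINT x:{0<..}|lebesgue. kernel_J h \<nu> \<mu> \<delta> lam a b r f ms s x * \<phi> x)"
    using Fubini_integral[OF joint_integrable]
    unfolding joint_integral_fst joint_integral_snd laplace_def set_lebesgue_integral_def .
qed

end

end

theorem theorem3p2:
  fixes h \<nu> :: real and r :: nat
    and \<mu> \<delta> lam a b :: complex and f :: "nat \<Rightarrow> complex" and ms :: "nat \<Rightarrow> nat" and m :: nat
    and \<phi> :: "real \<Rightarrow> complex"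
  assumes "h > 0" and "\<nu> > 0"
    and "Re \<mu> > 0" and "\<mu> \<notin> \<int>\<^sub>\<le>\<^sub>0"
    and "\<forall>j\<in>{1..r}. f j \<notin> \<int>\<^sub>\<le>\<^sub>0"
    and "m = (\<Sum>j=1..r. ms j)"
    and "Re (c1 h \<nu> lam) > - min 0 (Re (pk \<mu> a b m))"
    and "(\<lambda>x. of_real x powr (lam - \<delta>) * \<phi> x) absolutely_integrable_on {0<..}"
  shows "(AE x in lebesgue. x > 0 \<longrightarrow>
            J_integrand h \<nu> \<mu> \<delta> a b r f ms \<phi> x absolutely_integrable_on {x<..})
    \<and> (\<forall>s. Re s > 0 \<longrightarrow>
        (\<lambda>x. exp (- s * of_real x) * (of_real x powr lam * frac_J h \<nu> \<mu> \<delta> a b r f ms \<phi> x))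
            absolutely_integrable_on {0<..}
      \<and> (\<lambda>x. kernel_J h \<nu> \<mu> \<delta> lam a b r f ms s x * \<phi> x) absolutely_integrable_on {0<..}
      \<and> laplace (\<lambda>x. of_real x powr lam * frac_J h \<nu> \<mu> \<delta> a b r f ms \<phi> x) s
          = (LINT x:{0<..}|lebesgue. kernel_J h \<nu> \<mu> \<delta> lam a b r f ms s x * \<phi> x)
      \<and> (\<forall>x>0.
            I_integrand h \<nu> \<mu> a b r f ms (power_exp lam s) x absolutely_integrable_on {0<..<x}
          \<and> kernel_J h \<nu> \<mu> \<delta> lam a b r f ms s x
              = of_real x powr (lam - \<delta>) *
                (\<Sum>k=0..m. coeff_A r f ms k / coeff_A r f ms 0 * pochhammer a k * pochhammer b k *
                  fox_wright
                    [(c1 h \<nu> lam, 1 / \<nu>), (c1 h \<nu> lam + pk \<mu> a b k, 1 / \<nu>)]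
                    [(c1 h \<nu> lam + \<mu> - a, 1 / \<nu>), (c1 h \<nu> lam + \<mu> - b, 1 / \<nu>)]
                    (- s * of_real x))))"
proof -
  interpret frac_laplace h \<nu> r \<mu> \<delta> lam a b f ms m
    using assms by unfold_locales
  show ?thesis
  proof (intro conjI allI impI)
    show "AE x in lebesgue. x > 0 \<longrightarrow>
            J_integrand h \<nu> \<mu> \<delta> a b r f ms \<phi> x absolutely_integrable_on {x<..}"
      by (rule J_integrand_integrable_AE[OF assms(8), of 1]) simp
  next
    fix s :: complex and x :: real
    assume "x > 0"
    then show "I_integrand h \<nu> \<mu> a b r f ms (power_exp lam s) x absolutely_integrable_on {0<..<x}"
      by (rule kernel_integrand(1))
    show "kernel_J h \<nu> \<mu> \<delta> lam a b r f ms s x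
              = of_real x powr (lam - \<delta>) *
                (\<Sum>k=0..m. weight k *
                  fox_wright [(C, 1 / \<nu>), (C + pk \<mu> a b k, 1 / \<nu>)]
                    [(C + \<mu> - a, 1 / \<nu>), (C + \<mu> - b, 1 / \<nu>)] (- s * of_real x))"
      unfolding kernel_integrand(2)[OF \<open>x > 0\<close>] unit_kernel_exp_integral(2) ..
  qed (fact laplace_frac_J[OF assms(8)])+
qed

end
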